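(* Let $G$ be a relatively hyperbolic group. Then the group $\mathrm{Inn}(G)$ of inner automorphisms of $G$ is of finite index in $\mathrm{Conj}(G)$.
   Context: A finitely generated group $G$ is hyperbolic relative to a family $\mathcal{G}$ of finitely generated subgroups if $G$ admits a proper, discontinuous and isometric action on a proper, hyperbolic path metric space $X$ such that $G$ acts on the ideal boundary $\partial X$ of $X$ as a geometrically finite convergence group and the elements of $\mathcal{G}$ are the maximal parabolic subgroups of $G$ (this is one of Bowditch's equivalent definitions). Here geometrically finite means that every point of $\partial X$ is either a conical limit point or a bounded parabolic point. A point $p\in\partial X$ is a conical limit point if there are a sequence $(g_n)$ in $G$ and distinct points $a\ne b$ in $\partial X$ with $g_np\to a$ and $g_nx\to b$ for all $x\in\partial X\setminus\{p\}$. A point $p$ is bounded parabolic if its stabilizer $G_p$ is infinite, contains no loxodromic element, and acts cocompactly on $\partial X\setminus\{p\}$; the maximal parabolic subgroups are the stabilizers of such points. $G$ is relatively hyperbolic if it is hyperbolic relative to some such family $\mathcal{G}$. An automorphism $f$ of a group $G$ is called a conjugating automorphism if $f(g)$ is conjugate to $g$ in $G$ for every $g\in G$. The conjugating automorphisms form a normal subgroup $\mathrm{Conj}(G)$ of the automorphism group $\mathrm{Aut}(G)$, which contains $\mathrm{Inn}(G)$.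
   Formalization: The group G is required not to be itself one of the maximal parabolic subgroups in the family; without this every infinite finitely generated group would be relatively hyperbolic (relative to itself) and the claim would fail. *)

theory Defs
  imports "HOL-Analysis.Analysis" "HOL-Algebra.Generated_Groups" "HOL-Algebra.Group_Action"
begin

section \<open>Proper hyperbolic path metric spaces\<close>

text \<open>The space acted upon is a type of class \<^class>\<open>metric_space\<close>; a property of the whole space
  is a predicate on its type token.\<close>

definition proper_space :: "'x::metric_space itself \<Rightarrow> bool" where
  "proper_space X \<longleftrightarrow> (\<forall>(x::'x) r. compact (cball x r))"

definition path_length :: "(real \<Rightarrow> 'x::metric_space) \<Rightarrow> ennreal" where
  "path_length p =
     (SUP ts \<in> {ts. sorted ts \<and> set ts \<subseteq> {0..1}}.
        \<Sum>i<length ts - 1. ennreal (dist (p (ts ! i)) (p (ts ! Suc i))))"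

definition path_metric_space :: "'x::metric_space itself \<Rightarrow> bool" where
  "path_metric_space X \<longleftrightarrow>
     (\<forall>x y :: 'x. ennreal (dist x y) =
        (INF p \<in> {p. path p \<and> pathstart p = x \<and> pathfinish p = y}. path_length p))"

definition gromov_product :: "'x::metric_space \<Rightarrow> 'x \<Rightarrow> 'x \<Rightarrow> real" where
  "gromov_product w x y = (dist x w + dist y w - dist x y) / 2"

text \<open>Gromov's definition; for geodesic spaces it is equivalent to the existence of a uniform
  thinness constant for geodesic triangles.\<close>

definition gromov_hyperbolic :: "'x::metric_space itself \<Rightarrow> bool" where
  "gromov_hyperbolic X \<longleftrightarrow>
     (\<exists>\<delta>. \<forall>w x y z :: 'x.
        gromov_product w x z \<ge> min (gromov_product w x y) (gromov_product w y z) - \<delta>)"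


section \<open>The ideal boundary\<close>

text \<open>\<open>boundary_rel s t\<close> says that the Gromov product of \<open>s i\<close> and \<open>t j\<close> tends to infinity as
  \<open>i\<close> and \<open>j\<close> do.  Changing the basepoint \<open>w\<close> changes Gromov products by a bounded amount, so it is
  irrelevant whether \<open>w\<close> is quantified universally or existentially, here and below.\<close>

definition boundary_rel :: "(nat \<Rightarrow> 'x::metric_space) \<Rightarrow> (nat \<Rightarrow> 'x) \<Rightarrow> bool" where
  "boundary_rel s t \<longleftrightarrow>
     (\<forall>w. filterlim (\<lambda>(i, j). gromov_product w (s i) (t j)) at_top (sequentially \<times>\<^sub>F sequentially))"

definition gromov_sequences :: "(nat \<Rightarrow> 'x::metric_space) set" where
  "gromov_sequences = {s. boundary_rel s s}"

definition gromov_boundary :: "(nat \<Rightarrow> 'x::metric_space) set set" where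
  "gromov_boundary =
     gromov_sequences // {(s, t). s \<in> gromov_sequences \<and> t \<in> gromov_sequences \<and> boundary_rel s t}"

text \<open>The usual neighbourhood basis of a boundary point \<open>\<xi>\<close>, consisting of the boundary points whose
  Gromov product with \<open>\<xi>\<close> is large.\<close>

definition boundary_nbhd ::
    "'x::metric_space \<Rightarrow> real \<Rightarrow> (nat \<Rightarrow> 'x) set \<Rightarrow> (nat \<Rightarrow> 'x) set set" where
  "boundary_nbhd w r \<xi> =
     {\<eta> \<in> gromov_boundary. \<exists>s\<in>\<xi>. \<exists>t\<in>\<eta>.
        \<forall>\<^sub>F (i, j) in sequentially \<times>\<^sub>F sequentially. gromov_product w (s i) (t j) \<ge> r}"

definition boundary_topology :: "(nat \<Rightarrow> 'x::metric_space) set topology" where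
  "boundary_topology =
     topology (\<lambda>U. U \<subseteq> gromov_boundary \<and> (\<forall>\<xi>\<in>U. \<exists>w r. boundary_nbhd w r \<xi> \<subseteq> U))"

lemma gromov_product_basepoint: "gromov_product w x y \<ge> gromov_product v x y - dist v w"
proof -
  have "dist x v \<le> dist x w + dist v w" "dist y v \<le> dist y w + dist v w"
    by (metis dist_commute dist_triangle)+
  then show ?thesis
    by (simp add: gromov_product_def field_simps)
qed

lemma boundary_nbhd_mono:
  assumes "r + dist v w \<le> r'"
  shows "boundary_nbhd v r' \<xi> \<subseteq> boundary_nbhd w r \<xi>"
proof -
  have "gromov_product w x y \<ge> r" if "gromov_product v x y \<ge> r'" for x y :: 'a
    using that assms gromov_product_basepoint[of v x y w] by linarith
  then show ?thesis
    unfolding boundary_nbhd_def by (fastforce elim: eventually_mono)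
qed

lemma istopology_boundary:
  "istopology (\<lambda>U. U \<subseteq> gromov_boundary \<and> (\<forall>\<xi>\<in>U. \<exists>w r. boundary_nbhd w r \<xi> \<subseteq> U))"
  unfolding istopology_def
proof (intro conjI allI impI)
  fix S T :: "(nat \<Rightarrow> 'a) set set"
  assume S: "S \<subseteq> gromov_boundary \<and> (\<forall>\<xi>\<in>S. \<exists>w r. boundary_nbhd w r \<xi> \<subseteq> S)"
    and T: "T \<subseteq> gromov_boundary \<and> (\<forall>\<xi>\<in>T. \<exists>w r. boundary_nbhd w r \<xi> \<subseteq> T)"
  show "S \<inter> T \<subseteq> gromov_boundary"
    using S by blast
  show "\<forall>\<xi>\<in>S \<inter> T. \<exists>w r. boundary_nbhd w r \<xi> \<subseteq> S \<inter> T"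
  proof
    fix \<xi> assume "\<xi> \<in> S \<inter> T"
    then obtain w r v q where "boundary_nbhd w r \<xi> \<subseteq> S" "boundary_nbhd v q \<xi> \<subseteq> T"
      using S T by blast
    moreover have "boundary_nbhd w (max r (q + dist w v)) \<xi> \<subseteq> boundary_nbhd w r \<xi>"
      "boundary_nbhd w (max r (q + dist w v)) \<xi> \<subseteq> boundary_nbhd v q \<xi>"
      by (rule boundary_nbhd_mono; simp)+
    ultimately show "\<exists>w r. boundary_nbhd w r \<xi> \<subseteq> S \<inter> T"
      by blast
  qed
next
  fix \<K> :: "(nat \<Rightarrow> 'a) set set set"
  assume K: "\<forall>K\<in>\<K>. K \<subseteq> gromov_boundary \<and> (\<forall>\<xi>\<in>K. \<exists>w r. boundary_nbhd w r \<xi> \<subseteq> K)"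
  show "\<Union>\<K> \<subseteq> gromov_boundary"
    using K by blast
  show "\<forall>\<xi>\<in>\<Union>\<K>. \<exists>w r. boundary_nbhd w r \<xi> \<subseteq> \<Union>\<K>"
    using K by (meson Union_upper UnionE subset_trans)
qed

lemma openin_boundary_topology:
  "openin boundary_topology U \<longleftrightarrow>
     U \<subseteq> gromov_boundary \<and> (\<forall>\<xi>\<in>U. \<exists>w r. boundary_nbhd w r \<xi> \<subseteq> U)"
  by (simp add: boundary_topology_def topology_inverse'[OF istopology_boundary])

lemma topspace_boundary_topology [simp]: "topspace boundary_topology = gromov_boundary"
proof
  show "topspace boundary_topology \<subseteq> gromov_boundary"
    by (auto simp: topspace_def openin_boundary_topology)
  have "openin boundary_topology gromov_boundary"
    by (auto simp: openin_boundary_topology boundary_nbhd_def)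
  then show "gromov_boundary \<subseteq> topspace boundary_topology"
    by (rule openin_subset)
qed


section \<open>Geometrically finite convergence groups\<close>

definition properly_discontinuous ::
    "('g, 'm) monoid_scheme \<Rightarrow> 'a topology \<Rightarrow> ('g \<Rightarrow> 'a \<Rightarrow> 'a) \<Rightarrow> bool" where
  "properly_discontinuous G T \<psi> \<longleftrightarrow>
     (\<forall>K. compactin T K \<longrightarrow> finite {g \<in> carrier G. \<psi> g ` K \<inter> K \<noteq> {}})"

definition distinct_triples :: "'a topology \<Rightarrow> ('a \<times> 'a \<times> 'a) topology" where
  "distinct_triples T =
     subtopology (prod_topology T (prod_topology T T)) {(x, y, z). x \<noteq> y \<and> y \<noteq> z \<and> x \<noteq> z}"

definition convergence_group ::
    "('g, 'm) monoid_scheme \<Rightarrow> 'a topology \<Rightarrow> ('g \<Rightarrow> 'a \<Rightarrow> 'a) \<Rightarrow> bool" where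
  "convergence_group G T \<psi> \<longleftrightarrow>
     compact_space T \<and> metrizable_space T \<and>
     group_action G (topspace T) \<psi> \<and>
     (\<forall>g \<in> carrier G. homeomorphic_map T T (\<psi> g)) \<and>
     properly_discontinuous G (distinct_triples T) (\<lambda>g (x, y, z). (\<psi> g x, \<psi> g y, \<psi> g z))"

definition conical_limit_point ::
    "('g, 'm) monoid_scheme \<Rightarrow> 'a topology \<Rightarrow> ('g \<Rightarrow> 'a \<Rightarrow> 'a) \<Rightarrow> 'a \<Rightarrow> bool" where
  "conical_limit_point G T \<psi> p \<longleftrightarrow>
     p \<in> topspace T \<and>
     (\<exists>(g :: nat \<Rightarrow> 'g) a b. range g \<subseteq> carrier G \<and>
        a \<in> topspace T \<and> b \<in> topspace T \<and> a \<noteq> b \<and>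
        limitin T (\<lambda>n. \<psi> (g n) p) a sequentially \<and>
        (\<forall>x \<in> topspace T - {p}. limitin T (\<lambda>n. \<psi> (g n) x) b sequentially))"

definition loxodromic ::
    "('g, 'm) monoid_scheme \<Rightarrow> 'a topology \<Rightarrow> ('g \<Rightarrow> 'a \<Rightarrow> 'a) \<Rightarrow> 'g \<Rightarrow> bool" where
  "loxodromic G T \<psi> g \<longleftrightarrow>
     g \<in> carrier G \<and> (\<forall>n::nat. n > 0 \<longrightarrow> g [^]\<^bsub>G\<^esub> n \<noteq> \<one>\<^bsub>G\<^esub>) \<and>
     card (invariants (topspace T) \<psi> g) = 2"

definition acts_cocompactly_on :: "'g set \<Rightarrow> 'a topology \<Rightarrow> ('g \<Rightarrow> 'a \<Rightarrow> 'a) \<Rightarrow> 'a set \<Rightarrow> bool" where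
  "acts_cocompactly_on H T \<psi> Y \<longleftrightarrow>
     (\<exists>K. compactin T K \<and> K \<subseteq> Y \<and> (\<Union>g\<in>H. \<psi> g ` K) = Y)"

definition bounded_parabolic_point ::
    "('g, 'm) monoid_scheme \<Rightarrow> 'a topology \<Rightarrow> ('g \<Rightarrow> 'a \<Rightarrow> 'a) \<Rightarrow> 'a \<Rightarrow> bool" where
  "bounded_parabolic_point G T \<psi> p \<longleftrightarrow>
     p \<in> topspace T \<and>
     infinite (stabilizer G \<psi> p) \<and>
     (\<forall>g \<in> stabilizer G \<psi> p. \<not> loxodromic G T \<psi> g) \<and>
     acts_cocompactly_on (stabilizer G \<psi> p) T \<psi> (topspace T - {p})"

definition geometrically_finite ::
    "('g, 'm) monoid_scheme \<Rightarrow> 'a topology \<Rightarrow> ('g \<Rightarrow> 'a \<Rightarrow> 'a) \<Rightarrow> bool" where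
  "geometrically_finite G T \<psi> \<longleftrightarrow>
     (\<forall>p \<in> topspace T. conical_limit_point G T \<psi> p \<or> bounded_parabolic_point G T \<psi> p)"

definition maximal_parabolic_subgroups ::
    "('g, 'm) monoid_scheme \<Rightarrow> 'a topology \<Rightarrow> ('g \<Rightarrow> 'a \<Rightarrow> 'a) \<Rightarrow> 'g set set" where
  "maximal_parabolic_subgroups G T \<psi> =
     {stabilizer G \<psi> p | p. bounded_parabolic_point G T \<psi> p}"


section \<open>Relatively hyperbolic groups\<close>

definition finitely_generated_subgroup :: "('g, 'm) monoid_scheme \<Rightarrow> 'g set \<Rightarrow> bool" where
  "finitely_generated_subgroup G H \<longleftrightarrow>
     (\<exists>S. finite S \<and> S \<subseteq> carrier G \<and> generate G S = H)"

definition isometric_action ::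
    "('g, 'm) monoid_scheme \<Rightarrow> ('g \<Rightarrow> 'x::metric_space \<Rightarrow> 'x) \<Rightarrow> bool" where
  "isometric_action G \<phi> \<longleftrightarrow>
     group_action G UNIV \<phi> \<and> (\<forall>g \<in> carrier G. \<forall>x y. dist (\<phi> g x) (\<phi> g y) = dist x y)"

text \<open>A boundary point is a class of sequences, and a bijective isometry of the space maps each class
  onto a class.\<close>

definition boundary_action ::
    "('g \<Rightarrow> 'x::metric_space \<Rightarrow> 'x) \<Rightarrow> 'g \<Rightarrow> (nat \<Rightarrow> 'x) set \<Rightarrow> (nat \<Rightarrow> 'x) set" where
  "boundary_action \<phi> g = (\<lambda>\<xi> \<in> gromov_boundary. (\<lambda>s. \<phi> g \<circ> s) ` \<xi>)"

text \<open>HOL cannot quantify existentially over the space, so its type is a parameter.  A theorem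
  assuming these predicates for an arbitrary type \<open>'x\<close> covers every choice of the space.\<close>

definition hyperbolic_relative_to ::
    "'x::metric_space itself \<Rightarrow> ('g, 'm) monoid_scheme \<Rightarrow> 'g set set \<Rightarrow> bool" where
  "hyperbolic_relative_to X G \<P> \<longleftrightarrow>
     group G \<and> finitely_generated_subgroup G (carrier G) \<and>
     (\<forall>H \<in> \<P>. finitely_generated_subgroup G H) \<and>
     proper_space X \<and> gromov_hyperbolic X \<and> path_metric_space X \<and>
     (\<exists>\<phi> :: 'g \<Rightarrow> 'x \<Rightarrow> 'x.
        isometric_action G \<phi> \<and>
        properly_discontinuous G euclidean \<phi> \<and>
        convergence_group G boundary_topology (boundary_action \<phi>) \<and>
        geometrically_finite G boundary_topology (boundary_action \<phi>) \<and>
        \<P> = maximal_parabolic_subgroups G boundary_topology (boundary_action \<phi>))"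

text \<open>The members of the family are proper subgroups, as usual.  Otherwise every infinite finitely
  generated group would be relatively hyperbolic, being hyperbolic relative to itself: it acts on a
  horoball over its Cayley graph, whose ideal boundary is a single bounded parabolic point.\<close>

definition relatively_hyperbolic ::
    "'x::metric_space itself \<Rightarrow> ('g, 'm) monoid_scheme \<Rightarrow> bool" where
  "relatively_hyperbolic X G \<longleftrightarrow>
     (\<exists>\<P>. hyperbolic_relative_to X G \<P> \<and> carrier G \<notin> \<P>)"


section \<open>Inner and conjugating automorphisms\<close>

definition Inn :: "('g, 'm) monoid_scheme \<Rightarrow> ('g \<Rightarrow> 'g) set" where
  "Inn G = {(\<lambda>x \<in> carrier G. g \<otimes>\<^bsub>G\<^esub> x \<otimes>\<^bsub>G\<^esub> inv\<^bsub>G\<^esub> g) | g. g \<in> carrier G}"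

definition Conj :: "('g, 'm) monoid_scheme \<Rightarrow> ('g \<Rightarrow> 'g) set" where
  "Conj G =
     {f \<in> auto G. \<forall>g \<in> carrier G. \<exists>h \<in> carrier G. f g = h \<otimes>\<^bsub>G\<^esub> g \<otimes>\<^bsub>G\<^esub> inv\<^bsub>G\<^esub> h}"

abbreviation ConjGroup :: "('g, 'm) monoid_scheme \<Rightarrow> ('g \<Rightarrow> 'g) monoid" where
  "ConjGroup G \<equiv> AutoGroup G \<lparr>carrier := Conj G\<rparr>"

definition finite_index :: "'a set \<Rightarrow> ('a, 'm) monoid_scheme \<Rightarrow> bool" where
  "finite_index H K \<longleftrightarrow> subgroup H K \<and> finite (rcosets\<^bsub>K\<^esub> H)"

end

theory Submission
  imports Defs "HOL-Library.Diagonal_Subsequence"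
begin

text \<open>Fix a finite generating set \<open>S\<close> of \<open>G\<close>, acting on the hyperbolic space \<open>X\<close>, and a conjugating
  automorphism \<open>f\<close>.  The isometries \<open>f s\<close> and \<open>f s f t\<close> with \<open>s\<close>, \<open>t\<close> in \<open>S\<close> are conjugate to \<open>s\<close> and
  \<open>s t\<close>, so their minimal displacements are bounded independently of \<open>f\<close>.  By a coarse form of Serre's
  lemma the \<open>f s\<close> then displace a common point \<open>x\<close>, which may be taken in the hull of the
  boundary, by at most a constant.  After composing \<open>f\<close> with an inner automorphism, \<open>x\<close> is about as
  close to the base point as any point of its orbit.  If these points stay bounded as \<open>f\<close> varies,
  then proper discontinuity leaves finitely many choices for \<open>f\<close> on \<open>S\<close>.  Otherwise a sequence
  of them converges to a boundary point \<open>p\<close>.  It is not conical, as orbit points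
  tending to \<open>p\<close> radially would be closer to \<open>x\<close> than the base point.  If it is bounded parabolic,
  then \<open>x\<close> is eventually so deep in a horoball at \<open>p\<close> that the \<open>f s\<close>, moving \<open>x\<close> only a
  bounded amount, fix \<open>p\<close>; hence \<open>G\<close> is the stabiliser of \<open>p\<close>, which is excluded.\<close>

section \<open>Four-point geometry\<close>

text \<open>The model is a tree: an elliptic isometry \<open>g\<close> fixes the midpoint of
  \<open>x\<close> and \<open>g x\<close>, and two elliptic isometries with disjoint fixed sets have
  a product that translates. This is why the products \<open>f s \<circ> f t\<close> have to be
  controlled besides the \<open>f s\<close>. The hull enters because a bounded parabolic stabiliser
  is known to be cocompact on the boundary only, and so controls just those points of the space that
  lie near lines between boundary points. Depth in a horoball is measured by Busemann functions,
  which the stabiliser of a parabolic point preserves up to a constant: an element shifting them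
  would be loxodromic. Everything is coarse: near-shortest paths replace geodesics, near-infima
  replace minima, and \<open>1 \<le> \<delta>\<close> lets such additive errors be counted in
  multiples of \<open>\<delta>\<close>.\<close>

locale hyperbolic =
  fixes X :: "'x::metric_space itself" and \<delta> :: real
  assumes delta_ge_1: "1 \<le> \<delta>"
    and gromov_ineq: "\<And>w x y z :: 'x.
      min (gromov_product w x y) (gromov_product w y z) - \<delta> \<le> gromov_product w x z"
begin

lemma gromov_chain3:
  fixes w a b c d :: 'x
  shows "min (gromov_product w a b) (min (gromov_product w b c) (gromov_product w c d)) - 2 * \<delta>
    \<le> gromov_product w a d"
  using gromov_ineq[of w a b d] gromov_ineq[of w b c d] delta_ge_1 by linarith

lemma gromov_chain4:
  fixes w a b c d e :: 'x
  shows "min (min (gromov_product w a b) (gromov_product w b c))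
      (min (gromov_product w c d) (gromov_product w d e)) - 3 * \<delta> \<le> gromov_product w a e"
  using gromov_ineq[of w a b e] gromov_chain3[of w b c d e] delta_ge_1 by linarith

text \<open>This is \<open>gromov_ineq\<close> with the products multiplied out; no base point is
  left, so each use can pick the pairing of the four points that suits it.\<close>

lemma four_point:
  fixes w x y z :: 'x
  shows "dist x z + dist y w \<le> max (dist x y + dist z w) (dist x w + dist y z) + 2 * \<delta>"
  using gromov_ineq[of w x y z] unfolding gromov_product_def
  by (auto simp: min_def max_def field_simps dist_commute split: if_splits)

end

lemma gromov_product_commute: "gromov_product w x y = gromov_product w y x"
  by (simp add: gromov_product_def dist_commute)

section \<open>Isometries with a common almost fixed point\<close>

definition isometry :: "('x::metric_space \<Rightarrow> 'x) \<Rightarrow> bool" where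
  "isometry g \<longleftrightarrow> (\<forall>x y. dist (g x) (g y) = dist x y)"

lemma isometryD: "isometry g \<Longrightarrow> dist (g x) (g y) = dist x y"
  by (simp add: isometry_def)

text \<open>The error \<open>\<kappa>\<close> is there for sets such as the hull of the boundary,
  which comes near every point of a segment between its points but need not contain the
  segment.\<close>

definition rough_geodesic :: "real \<Rightarrow> 'x::metric_space set \<Rightarrow> bool" where
  "rough_geodesic \<kappa> Y \<longleftrightarrow> (\<forall>x\<in>Y. \<forall>y\<in>Y. \<forall>t. 0 \<le> t \<and> t \<le> dist x y \<longrightarrow>
     (\<exists>z\<in>Y. dist x z \<le> t + \<kappa> \<and> dist z y \<le> dist x y - t + \<kappa>))"

lemma rough_geodesic_mono:
  assumes "rough_geodesic \<kappa> Y" "\<kappa> \<le> \<kappa>'" shows "rough_geodesic \<kappa>' Y"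
  unfolding rough_geodesic_def
proof (intro ballI allI impI)
  fix x y t assume "x \<in> Y" "y \<in> Y" "0 \<le> t \<and> t \<le> dist x y"
  then obtain z where "z \<in> Y" "dist x z \<le> t + \<kappa>" "dist z y \<le> dist x y - t + \<kappa>"
    using assms(1) unfolding rough_geodesic_def by blast
  then show "\<exists>z\<in>Y. dist x z \<le> t + \<kappa>' \<and> dist z y \<le> dist x y - t + \<kappa>'"
    using assms(2) by (intro bexI[of _ z]) auto
qed

context hyperbolic
begin

text \<open>In a tree \<open>z\<close> would be fixed and would project to the midpoint of
  \<open>x\<close> and \<open>g x\<close>. Coarsely, the first four-point inequality says that
  \<open>m\<close> lies between \<open>x\<close> and \<open>z\<close>; the second compares
  \<open>m\<close> and \<open>g m\<close>, which lie between \<open>g x\<close> and \<open>z\<close>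
  at about the same depth.\<close>

lemma midpoint_almost_fixed:
  fixes g :: "'x \<Rightarrow> 'x"
  assumes g: "isometry g" and z: "dist z (g z) \<le> L"
    and m: "dist x m \<le> dist x (g x) / 2 + \<kappa>" "dist m (g x) \<le> dist x (g x) / 2 + \<kappa>"
  shows "dist m (g m) \<le> 3 * L + 2 * \<kappa> + 4 * \<delta>"
proof -
  let ?a = "dist x z"
  have zgx: "dist (g x) z \<le> ?a + L" "?a - L \<le> dist (g x) z"
    using dist_triangle[of "g x" z "g z"] dist_triangle[of "g x" "g z" z] z isometryD[OF g, of x z]
    by (auto simp: dist_commute)
  have "dist z m + dist x (g x) \<le> max (dist z x + dist m (g x)) (dist z (g x) + dist x m) + 2 * \<delta>"
    by (rule four_point)
  then have zm: "dist z m \<le> ?a + L - dist x (g x) / 2 + \<kappa> + 2 * \<delta>"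
    using zgx m z zero_le_dist[of z "g z"] by (auto simp: dist_commute)
  have "dist m (g m) + dist (g x) z \<le> max (dist m (g x) + dist (g m) z) (dist m z + dist (g x) (g m)) + 2 * \<delta>"
    by (rule four_point)
  moreover have "dist (g m) z \<le> dist z m + L"
    using dist_triangle[of "g m" z "g z"] z isometryD[OF g, of m z] by (simp add: dist_commute)
  moreover have "dist (g x) (g m) = dist x m"
    by (rule isometryD[OF g])
  moreover have "0 \<le> L"
    using z zero_le_dist[of z "g z"] by linarith
  ultimately show ?thesis
    using zgx zm m by (auto simp: dist_commute)
qed

text \<open>If the almost fixed points \<open>m\<close> of \<open>s\<close> and \<open>m'\<close> of \<open>h\<close> lie in opposite directions from \<open>x\<close>,
  then \<open>s \<circ> h\<close> displaces \<open>x\<close> by about the sum of the two displacements.\<close>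

lemma displacement_of_product:
  fixes s h :: "'x \<Rightarrow> 'x"
  assumes s: "isometry s" and K: "\<delta> \<le> K" and \<Lambda>: "400 * K \<le> \<Lambda>"
    and m: "dist x m \<le> \<Lambda> / 2 + K" "\<Lambda> / 2 - 22 * K \<le> dist x m" "dist m (s x) \<le> \<Lambda> / 2 + K"
      "dist x (s x) \<le> \<Lambda>" "\<Lambda> - 46 * K \<le> dist x (s x)" "dist m (s m) \<le> 9 * K"
    and m': "dist x m' \<le> \<Lambda> / 2 + K" "\<Lambda> / 2 - 22 * K \<le> dist x m'" "dist m' (h x) \<le> \<Lambda> / 2 + K"
      "\<Lambda> - 46 * K \<le> dist x (h x)"
    and mm': "\<Lambda> - 21 * K \<le> dist m m'"
  shows "2 * \<Lambda> - 130 * K \<le> dist x (s (h x))"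
proof -
  note i = isometryD[OF s]
  let ?w = "s x"
  have tr: "dist x (s x) - dist x m \<le> dist m (s x)"
    using dist_triangle[of x "s x" m] by linarith
  \<comment> \<open>Seen from \<open>s x\<close>, the points \<open>s m\<close>, \<open>m\<close>,
    \<open>x\<close> lie in one direction and \<open>s m'\<close>, \<open>s (h x)\<close> in
    another. A chain from \<open>s m\<close> to \<open>s m'\<close> passes through \<open>x\<close>
    and \<open>s (h x)\<close>, and only the link between these two can be small.\<close>
  have "gromov_product ?w (s m) (s m') \<le> 12 * K"
    using m m' mm' unfolding gromov_product_def i by (auto simp: dist_commute)
  moreover have "gromov_product ?w (s m) m \<ge> 100 * K"
    using m \<Lambda> K delta_ge_1 tr unfolding gromov_product_def i by (auto simp: dist_commute)
  moreover have "gromov_product ?w m x \<ge> 100 * K"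
    using m \<Lambda> K delta_ge_1 tr unfolding gromov_product_def i by (auto simp: dist_commute)
  moreover have "gromov_product ?w (s (h x)) (s m') \<ge> 100 * K"
    using m' \<Lambda> K delta_ge_1 unfolding gromov_product_def i by (auto simp: dist_commute)
  ultimately have "gromov_product ?w x (s (h x)) \<le> 15 * K"
    using gromov_chain4[of ?w "s m" m x "s (h x)" "s m'"] K delta_ge_1 by linarith
  then show ?thesis
    using m m' K delta_ge_1 unfolding gromov_product_def i by (auto simp: dist_commute)
qed

text \<open>A coarse form of Serre's lemma on groups generated by elliptic isometries of a tree: at a
  point where the largest displacement of the generators is almost minimal, two generators of large
  displacement pull in opposite directions, so that their product has no almost fixed point.\<close>

theorem common_almost_fixed_point:
  fixes f :: "'i \<Rightarrow> 'x \<Rightarrow> 'x"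
  assumes K: "\<delta> \<le> K" and Y: "rough_geodesic K Y" "Y \<noteq> {}" and S: "finite S"
    and isom: "\<And>s. s \<in> S \<Longrightarrow> isometry (f s)"
    and inv: "\<And>s x. s \<in> S \<Longrightarrow> x \<in> Y \<Longrightarrow> f s x \<in> Y"
    and fix1: "\<And>s. s \<in> S \<Longrightarrow> \<exists>z. dist z (f s z) \<le> K"
    and fix2: "\<And>s t. s \<in> S \<Longrightarrow> t \<in> S \<Longrightarrow> \<exists>z. dist z (f s (f t z)) \<le> K"
  shows "\<exists>x\<in>Y. \<forall>s\<in>S. dist x (f s x) \<le> 400 * K"
proof (cases "S = {}")
  case True
  then show ?thesis using Y by auto
next
  case False
  have K1: "1 \<le> K" using K delta_ge_1 by linarith
  define \<Phi> where "\<Phi> x = Max ((\<lambda>s. dist x (f s x)) ` S)" for x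
  have \<Phi>_ge: "dist x (f s x) \<le> \<Phi> x" if "s \<in> S" for s x
    unfolding \<Phi>_def using S that by (intro Max_ge) auto
  have \<Phi>_attained: "\<exists>s\<in>S. \<Phi> x = dist x (f s x)" for x
  proof -
    have "\<Phi> x \<in> (\<lambda>s. dist x (f s x)) ` S"
      unfolding \<Phi>_def using S False by (intro Max_in) auto
    then show ?thesis by auto
  qed
  have \<Phi>_nonneg: "0 \<le> \<Phi> x" for x
    using \<Phi>_attained[of x] by auto
  \<comment> \<open>The infimum need not be attained; the slack \<open>1\<close> is at most
    \<open>K\<close>.\<close>
  obtain x where x: "x \<in> Y" and near_min: "\<And>y. y \<in> Y \<Longrightarrow> \<Phi> x - 1 \<le> \<Phi> y"
  proof -
    have "Inf (\<Phi> ` Y) < Inf (\<Phi> ` Y) + 1" by simp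
    then obtain x where "x \<in> Y" "\<Phi> x < Inf (\<Phi> ` Y) + 1"
      using cInf_lessD[of "\<Phi> ` Y"] Y(2) by blast
    moreover have "Inf (\<Phi> ` Y) \<le> \<Phi> y" if "y \<in> Y" for y
      using that \<Phi>_nonneg by (intro cInf_lower) (auto intro!: bdd_belowI[of _ 0])
    ultimately show thesis using that by (smt (verit))
  qed
  have "\<Phi> x \<le> 400 * K"
  proof (rule ccontr)
    assume "\<not> \<Phi> x \<le> 400 * K"
    define \<Lambda> where "\<Lambda> = \<Phi> x"
    have \<Lambda>: "400 * K < \<Lambda>" using \<open>\<not> \<Phi> x \<le> 400 * K\<close> by (simp add: \<Lambda>_def)
    have mid: "\<exists>m\<in>Y. dist x m \<le> dist x (f s x) / 2 + K \<and> dist m (f s x) \<le> dist x (f s x) / 2 + K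
        \<and> dist m (f s m) \<le> 9 * K" if s: "s \<in> S" for s
    proof -
      obtain m where m: "m \<in> Y" "dist x m \<le> dist x (f s x) / 2 + K"
          "dist m (f s x) \<le> dist x (f s x) - dist x (f s x) / 2 + K"
        using Y(1) x inv[OF s x] unfolding rough_geodesic_def
        by (metis divide_nonneg_nonneg field_sum_of_halves le_add_same_cancel1 zero_le_dist zero_le_numeral)
      moreover obtain z where "dist z (f s z) \<le> K" using fix1[OF s] by blast
      ultimately have "dist m (f s m) \<le> 3 * K + 2 * K + 4 * \<delta>"
        by (intro midpoint_almost_fixed[OF isom[OF s], where x = x]) auto
      then show ?thesis using m K by (intro bexI[of _ m]) auto
    qed
    obtain s where s: "s \<in> S" "dist x (f s x) = \<Lambda>"
      using \<Phi>_attained[of x] \<Lambda>_def by auto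
    obtain m where m: "m \<in> Y" "dist x m \<le> \<Lambda> / 2 + K" "dist m (f s x) \<le> \<Lambda> / 2 + K"
        "dist m (f s m) \<le> 9 * K"
      using mid[OF s(1)] s(2) by auto
    have m_ge: "\<Lambda> / 2 - K \<le> dist x m"
      using dist_triangle[of x "f s x" m] s m by linarith
    \<comment> \<open>By near-minimality some generator \<open>h\<close> still moves
      \<open>x'\<close> by almost \<open>\<Lambda>\<close>, so going from \<open>x\<close> towards
      \<open>m\<close> has not led towards its almost fixed point \<open>m'\<close>. The step length
      \<open>12 * K\<close> makes the gain of \<open>11 * K\<close> on the way to \<open>m\<close>
      exceed the losses \<open>5 * K\<close>, \<open>K\<close> and \<open>2 * \<delta>\<close> in
      the comparison below.\<close>
    obtain x' where x': "x' \<in> Y" "dist x x' \<le> 12 * K + K" "dist x' m \<le> dist x m - 12 * K + K"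
    proof -
      have "0 \<le> 12 * K \<and> 12 * K \<le> dist x m" using m_ge K1 \<Lambda> by linarith
      then show thesis
        using Y(1) x m(1) that unfolding rough_geodesic_def by blast
    qed
    obtain h where h: "h \<in> S" "dist x' (f h x') \<ge> \<Lambda> - 1"
      using \<Phi>_attained[of x'] near_min[OF x'(1)] \<Lambda>_def by auto
    obtain m' where m': "m' \<in> Y" "dist x m' \<le> dist x (f h x) / 2 + K"
        "dist m' (f h x) \<le> dist x (f h x) / 2 + K" "dist m' (f h m') \<le> 9 * K"
      using mid[OF h(1)] by auto
    have hx: "dist x (f h x) \<le> \<Lambda>" using \<Phi>_ge[OF h(1)] \<Lambda>_def by auto
    have "dist x' (f h x') \<le> 2 * dist x' m' + 9 * K"
      using dist_triangle[of x' "f h x'" m'] dist_triangle[of m' "f h x'" "f h m'"] m'(4)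
        isometryD[OF isom[OF h(1)], of m' x'] by (simp add: dist_commute)
    then have x'm': "\<Lambda> / 2 - 5 * K \<le> dist x' m'"
      using h(2) K1 by linarith
    have "dist x' m' + dist x m \<le> max (dist x' x + dist m' m) (dist x' m + dist x m') + 2 * \<delta>"
      by (rule four_point)
    moreover have "dist x' m' + dist x m > dist x' m + dist x m' + 2 * \<delta>"
      using x'm' x' m' hx m_ge m K K1 by linarith
    ultimately have mm': "\<Lambda> - 21 * K \<le> dist m m'"
      using x'm' x'(2) K K1 m_ge by (auto simp: dist_commute)
    have m'_ge: "\<Lambda> / 2 - 22 * K \<le> dist x m'"
      using dist_triangle3[of m m' x] mm' m by linarith
    have hx_ge: "\<Lambda> - 46 * K \<le> dist x (f h x)"
      using m'_ge m'(2) by linarith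
    have "2 * \<Lambda> - 130 * K \<le> dist x (f s (f h x))"
      using isom[OF s(1)] K \<Lambda> m m_ge s K1 m' m'_ge hx hx_ge mm'
      by (intro displacement_of_product[where m = m and m' = m']) linarith+
    moreover have "2 * \<Lambda> - 130 * K \<le> dist x (f h (f s x))"
      using isom[OF h(1)] K \<Lambda> m m_ge s K1 m' m'_ge hx hx_ge mm'
      by (intro displacement_of_product[where m = m' and m' = m]) (simp_all add: dist_commute)
    moreover obtain z where "dist z (f s (f h z)) \<le> K"
      using fix2[OF s(1) h(1)] by blast
    moreover have "isometry (\<lambda>y. f s (f h y))"
      using isom s h by (simp add: isometry_def)
    \<comment> \<open>Both halves are at most \<open>\<Lambda>\<close>, so \<open>f s x\<close> is a
      midpoint of \<open>x\<close> and \<open>f s (f h x)\<close> up to \<open>65 * K\<close>. Hence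
      \<open>f s \<circ> f h\<close> almost fixes it, that is, \<open>f h \<circ> f s\<close> moves
      \<open>x\<close> little, against the lower bound just obtained.\<close>
    ultimately have "dist (f s x) (f s (f h (f s x))) \<le> 3 * K + 2 * (65 * K) + 4 * \<delta>"
      using s hx isometryD[OF isom[OF s(1)], of x "f h x"]
      by (intro midpoint_almost_fixed[where z = z and x = x]) auto
    then have "dist x (f h (f s x)) \<le> 137 * K"
      using isometryD[OF isom[OF s(1)], of x "f h (f s x)"] K by simp
    then show False
      using \<open>2 * \<Lambda> - 130 * K \<le> dist x (f h (f s x))\<close> \<Lambda> K1 by linarith
  qed
  then show ?thesis
    using x \<Phi>_ge by (meson order_trans)
qed

end

section \<open>Ends and Busemann functions\<close>

text \<open>One base point suffices on the right, while the definition asks for all; later proofs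
  take \<open>undefined\<close> when no point is at hand.\<close>

lemma boundary_rel_iff:
  "boundary_rel s t \<longleftrightarrow> (\<forall>C. \<exists>N. \<forall>i\<ge>N. \<forall>j\<ge>N. C \<le> gromov_product w (s i) (t j))"
proof -
  have *: "filterlim (\<lambda>(i, j). gromov_product v (s i) (t j)) at_top (sequentially \<times>\<^sub>F sequentially)
      \<longleftrightarrow> (\<forall>C. \<exists>N. \<forall>i\<ge>N. \<forall>j\<ge>N. C \<le> gromov_product v (s i) (t j))" for v
    unfolding filterlim_at_top eventually_prod_sequentially prod.case by meson
  have "\<forall>C. \<exists>N. \<forall>i\<ge>N. \<forall>j\<ge>N. C \<le> gromov_product v (s i) (t j)"
    if w: "\<forall>C. \<exists>N. \<forall>i\<ge>N. \<forall>j\<ge>N. C \<le> gromov_product w (s i) (t j)" for v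
  proof
    fix C
    obtain N where "\<forall>i\<ge>N. \<forall>j\<ge>N. C + dist w v \<le> gromov_product w (s i) (t j)"
      using w by blast
    then show "\<exists>N. \<forall>i\<ge>N. \<forall>j\<ge>N. C \<le> gromov_product v (s i) (t j)"
      using gromov_product_basepoint[of w _ _ v] by (intro exI[of _ N]) (smt (verit))
  qed
  then show ?thesis
    unfolding boundary_rel_def * by blast
qed

lemma boundary_rel_sym: "boundary_rel s t \<Longrightarrow> boundary_rel t s"
  unfolding boundary_rel_iff[where w = undefined] by (metis gromov_product_commute)

text \<open>Unlike \<open>boundary_action\<close> this is not restricted to
  \<open>gromov_boundary\<close>, so it composes without side conditions.\<close>

definition push :: "('x \<Rightarrow> 'x) \<Rightarrow> (nat \<Rightarrow> 'x) set \<Rightarrow> (nat \<Rightarrow> 'x) set" where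
  "push g A = (\<lambda>s. g \<circ> s) ` A"

lemma push_comp: "push g (push h A) = push (g \<circ> h) A"
  by (simp add: push_def image_image comp_assoc)

lemma comp_in_push: "s \<in> A \<Longrightarrow> g \<circ> s \<in> push g A"
  by (simp add: push_def)

text \<open>The Gromov product of \<open>A\<close> and \<open>B\<close> is at most \<open>C\<close>, where a set of sequences stands for
  a boundary point, or for the point \<open>x\<close> of the space if it is \<open>{\<lambda>_. x}\<close>; geometrically, \<open>w\<close> is
  close to a geodesic from \<open>A\<close> to \<open>B\<close>.  The frequent upper bound along some pair of sequences
  gives an eventual one along all pairs, at the cost of \<open>2 * \<delta>\<close>.\<close>

definition gromov_le :: "'x::metric_space \<Rightarrow> (nat \<Rightarrow> 'x) set \<Rightarrow> (nat \<Rightarrow> 'x) set \<Rightarrow> real \<Rightarrow> bool" where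
  "gromov_le w A B C \<longleftrightarrow> (\<exists>s\<in>A. \<exists>t\<in>B. \<forall>N. \<exists>i\<ge>N. \<exists>j\<ge>N. gromov_product w (s i) (t j) \<le> C)"

lemma gromov_le_commute: "gromov_le w A B C \<Longrightarrow> gromov_le w B A C"
  unfolding gromov_le_def by (metis gromov_product_commute)

lemma gromov_le_mono: "gromov_le w A B C \<Longrightarrow> C \<le> C' \<Longrightarrow> gromov_le w A B C'"
  unfolding gromov_le_def by (meson order_trans)

lemma gromov_le_push:
  assumes "isometry g" "gromov_le w A B C" shows "gromov_le (g w) (push g A) (push g B) C"
proof -
  have *: "gromov_product (g w) (g x) (g y) = gromov_product w x y" for x y
    using assms(1) by (simp add: gromov_product_def isometry_def)
  show ?thesis
    using assms(2) unfolding gromov_le_def push_def by (auto simp: *)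
qed

context hyperbolic
begin

lemma boundary_rel_trans:
  fixes s t u :: "nat \<Rightarrow> 'x"
  assumes "boundary_rel s t" "boundary_rel t u" shows "boundary_rel s u"
  unfolding boundary_rel_iff[where w = undefined]
proof
  fix C
  obtain N where N: "\<forall>i\<ge>N. \<forall>j\<ge>N. C + \<delta> \<le> gromov_product undefined (s i) (t j)"
    using assms(1) unfolding boundary_rel_iff[where w = undefined] by blast
  obtain M where M: "\<forall>i\<ge>M. \<forall>j\<ge>M. C + \<delta> \<le> gromov_product undefined (t i) (u j)"
    using assms(2) unfolding boundary_rel_iff[where w = undefined] by blast
  have "C \<le> gromov_product undefined (s i) (u j)" if "max M N \<le> i" "max M N \<le> j" for i j
    using gromov_ineq[of undefined "s i" "t (max M N)" "u j"] N M that
    by (smt (verit) max.bounded_iff max.cobounded1 max.cobounded2)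
  then show "\<exists>N. \<forall>i\<ge>N. \<forall>j\<ge>N. C \<le> gromov_product undefined (s i) (u j)" by blast
qed

lemma boundary_rel_in_boundary:
  fixes \<xi> :: "(nat \<Rightarrow> 'x) set"
  assumes "\<xi> \<in> gromov_boundary" "s \<in> \<xi>" "t \<in> \<xi>" shows "boundary_rel s t"
  using assms boundary_rel_trans boundary_rel_sym
  unfolding gromov_boundary_def quotient_def by blast

lemma boundary_nonempty:
  fixes \<xi> :: "(nat \<Rightarrow> 'x) set"
  assumes "\<xi> \<in> gromov_boundary" obtains s where "s \<in> \<xi>"
  using assms unfolding gromov_boundary_def quotient_def gromov_sequences_def by auto

lemma boundary_closed:
  fixes \<xi> :: "(nat \<Rightarrow> 'x) set"
  assumes "\<xi> \<in> gromov_boundary" "s \<in> \<xi>" "boundary_rel s t" shows "t \<in> \<xi>"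
  using assms boundary_rel_trans[of _ s t] boundary_rel_sym[of s t] boundary_rel_trans[of t s t]
  unfolding gromov_boundary_def quotient_def gromov_sequences_def by auto

lemma boundary_eqI:
  fixes \<xi> \<eta> :: "(nat \<Rightarrow> 'x) set"
  assumes "\<xi> \<in> gromov_boundary" "\<eta> \<in> gromov_boundary" "s \<in> \<xi>" "t \<in> \<eta>" "boundary_rel s t"
  shows "\<xi> = \<eta>"
proof -
  have "t \<in> \<xi>" using boundary_closed assms by blast
  then have "u \<in> \<xi> \<longleftrightarrow> u \<in> \<eta>" for u
    using assms boundary_closed boundary_rel_in_boundary by metis
  then show ?thesis by blast
qed

lemma gromov_sequence_in_boundary:
  fixes s :: "nat \<Rightarrow> 'x"
  assumes "s \<in> gromov_sequences" obtains \<xi> where "\<xi> \<in> gromov_boundary" "s \<in> \<xi>"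
  using assms unfolding gromov_boundary_def quotient_def gromov_sequences_def by auto

lemma boundary_rel_bounded_dist:
  fixes s t :: "nat \<Rightarrow> 'x"
  assumes "boundary_rel s s" "\<And>i. dist (s i) (t i) \<le> B" shows "boundary_rel s t"
  unfolding boundary_rel_iff[where w = undefined]
proof
  fix C
  obtain N where N: "\<forall>i\<ge>N. \<forall>j\<ge>N. C + B \<le> gromov_product undefined (s i) (s j)"
    using assms(1) unfolding boundary_rel_iff[where w = undefined] by blast
  have "gromov_product undefined x y - dist y z \<le> gromov_product undefined x z" for x y z :: 'x
    using dist_triangle2[of x z y] dist_triangle[of y undefined z]
    unfolding gromov_product_def by (simp add: field_simps dist_commute)
  then have "C \<le> gromov_product undefined (s i) (t j)" if "N \<le> i" "N \<le> j" for i j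
    using that N assms(2)[of j] by (smt (verit))
  then show "\<exists>N. \<forall>i\<ge>N. \<forall>j\<ge>N. C \<le> gromov_product undefined (s i) (t j)" by blast
qed

text \<open>The property shared by boundary points and the sets \<open>{\<lambda>_. x}\<close> that
  makes the sequences in a set interchangeable in upper bounds of Gromov products. Uniformity in
  \<open>z\<close> allows the two arguments to be replaced one after the other.\<close>

definition coherent :: "(nat \<Rightarrow> 'x) set \<Rightarrow> bool" where
  "coherent A \<longleftrightarrow> (\<forall>s\<in>A. \<forall>s'\<in>A. \<forall>w C. \<exists>N. \<forall>i\<ge>N. \<forall>i'\<ge>N. \<forall>z.
     gromov_product w (s' i') z \<le> C \<longrightarrow> gromov_product w (s i) z \<le> C + \<delta>)"

lemma coherent_point: "coherent {\<lambda>_. x}"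
  using delta_ge_1 unfolding coherent_def by auto

lemma coherent_boundary:
  assumes "\<xi> \<in> gromov_boundary" shows "coherent \<xi>"
  unfolding coherent_def
proof (intro ballI allI)
  fix s s' and w :: 'x and C :: real assume "s \<in> \<xi>" "s' \<in> \<xi>"
  then obtain N where N: "\<forall>i\<ge>N. \<forall>j\<ge>N. C + 2 * \<delta> \<le> gromov_product w (s' i) (s j)"
    using boundary_rel_in_boundary[OF assms] unfolding boundary_rel_iff[where w = w] by blast
  show "\<exists>N. \<forall>i\<ge>N. \<forall>i'\<ge>N. \<forall>z. gromov_product w (s' i') z \<le> C \<longrightarrow> gromov_product w (s i) z \<le> C + \<delta>"
  proof (intro exI allI impI)
    fix i i' z assume "N \<le> i" "N \<le> i'" "gromov_product w (s' i') z \<le> C"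
    then show "gromov_product w (s i) z \<le> C + \<delta>"
      using N gromov_ineq[of w "s' i'" "s i" z] delta_ge_1 by (smt (verit))
  qed
qed

lemma gromov_le_eventually:
  assumes "gromov_le w A B C" "coherent A" "coherent B" "s \<in> A" "t \<in> B"
  shows "\<exists>N. \<forall>i\<ge>N. \<forall>j\<ge>N. gromov_product w (s i) (t j) \<le> C + 2 * \<delta>"
proof -
  obtain s' t' where st: "s' \<in> A" "t' \<in> B"
    and freq: "\<And>N. \<exists>i\<ge>N. \<exists>j\<ge>N. gromov_product w (s' i) (t' j) \<le> C"
    using assms unfolding gromov_le_def by blast
  obtain N where N: "\<And>i i' z. N \<le> i \<Longrightarrow> N \<le> i' \<Longrightarrow>
      gromov_product w (s' i') z \<le> C \<Longrightarrow> gromov_product w (s i) z \<le> C + \<delta>"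
    using \<open>coherent A\<close> \<open>s \<in> A\<close> st unfolding coherent_def by blast
  obtain M where M: "\<And>j j' z. M \<le> j \<Longrightarrow> M \<le> j' \<Longrightarrow>
      gromov_product w (t' j') z \<le> C + \<delta> \<Longrightarrow> gromov_product w (t j) z \<le> (C + \<delta>) + \<delta>"
    using \<open>coherent B\<close> \<open>t \<in> B\<close> st unfolding coherent_def by blast
  obtain i' j' where "max M N \<le> i'" "max M N \<le> j'" "gromov_product w (s' i') (t' j') \<le> C"
    using freq[of "max M N"] by blast
  then have "gromov_product w (s i) (t j) \<le> C + 2 * \<delta>" if "max M N \<le> i" "max M N \<le> j" for i j
    using N[of i i' "t' j'"] M[of j j' "s i"] that
    by (simp add: gromov_product_commute[of w "s i"])
  then show ?thesis by blast
qed

text \<open>Thinness of triangles: a point near one side is near one of the other two, whatever the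
  third vertex \<open>D\<close>.\<close>

lemma gromov_le_split:
  assumes "gromov_le (w :: 'x) A B C" "D \<noteq> {}"
  shows "gromov_le w A D (C + \<delta>) \<or> gromov_le w D B (C + \<delta>)"
proof (rule ccontr)
  assume neg: "\<not> ?thesis"
  obtain s t where st: "s \<in> A" "t \<in> B"
    and freq: "\<And>N. \<exists>i\<ge>N. \<exists>j\<ge>N. gromov_product w (s i) (t j) \<le> C"
    using assms unfolding gromov_le_def by blast
  obtain u where "u \<in> D" using assms by blast
  have "\<not> gromov_le w A D (C + \<delta>)" "\<not> gromov_le w D B (C + \<delta>)" using neg by auto
  then have "\<not> (\<forall>N. \<exists>i\<ge>N. \<exists>j\<ge>N. gromov_product w (s i) (u j) \<le> C + \<delta>)"
    "\<not> (\<forall>N. \<exists>i\<ge>N. \<exists>j\<ge>N. gromov_product w (u i) (t j) \<le> C + \<delta>)"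
    using st \<open>u \<in> D\<close> unfolding gromov_le_def by blast+
  then obtain N M where N: "\<forall>i\<ge>N. \<forall>j\<ge>N. \<not> gromov_product w (s i) (u j) \<le> C + \<delta>"
    and M: "\<forall>i\<ge>M. \<forall>j\<ge>M. \<not> gromov_product w (u i) (t j) \<le> C + \<delta>"
    by auto
  obtain i j where "max M N \<le> i" "max M N \<le> j" "gromov_product w (s i) (t j) \<le> C"
    using freq[of "max M N"] by blast
  then show False
    using N[rule_format, of i "max M N"] M[rule_format, of "max M N" j] gromov_ineq[of w "s i" "u (max M N)" "t j"] by auto
qed

lemma not_gromov_le_self:
  assumes "\<xi> \<in> gromov_boundary" shows "\<not> gromov_le (w :: 'x) \<xi> \<xi> C"
proof
  assume le: "gromov_le w \<xi> \<xi> C"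
  obtain s where s: "s \<in> \<xi>" using boundary_nonempty[OF assms] .
  obtain N where N: "\<forall>i\<ge>N. \<forall>j\<ge>N. gromov_product w (s i) (s j) \<le> C + 2 * \<delta>"
    using gromov_le_eventually[OF le _ _ s s] coherent_boundary assms by blast
  obtain M where M: "\<forall>i\<ge>M. \<forall>j\<ge>M. C + 3 * \<delta> \<le> gromov_product w (s i) (s j)"
    using boundary_rel_in_boundary[OF assms s s] boundary_rel_iff[of s s w] by blast
  show False
    using N[rule_format, of "max M N" "max M N"] M[rule_format, of "max M N" "max M N"] delta_ge_1
    by simp
qed

lemma gromov_le_distinct:
  assumes "\<xi> \<in> gromov_boundary" "\<eta> \<in> gromov_boundary" "\<xi> \<noteq> \<eta>"
  obtains C where "0 \<le> C" "gromov_le (w :: 'x) \<xi> \<eta> C"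
proof -
  obtain s t where st: "s \<in> \<xi>" "t \<in> \<eta>" using boundary_nonempty assms by metis
  then have "\<not> boundary_rel s t" using boundary_eqI assms by blast
  then obtain C where C: "\<And>N. \<exists>i\<ge>N. \<exists>j\<ge>N. \<not> C \<le> gromov_product w (s i) (t j)"
    unfolding boundary_rel_iff[where w = w] by blast
  have "gromov_le w \<xi> \<eta> (max 0 C)"
    unfolding gromov_le_def
  proof (intro bexI allI)
    fix N
    obtain i j where "N \<le> i" "N \<le> j" "\<not> C \<le> gromov_product w (s i) (t j)" using C by blast
    then show "\<exists>i\<ge>N. \<exists>j\<ge>N. gromov_product w (s i) (t j) \<le> max 0 C"
      by (intro exI[of _ i] exI[of _ j] conjI) auto
  qed (use st in auto)
  then show thesis using that[of "max 0 C"] by simp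
qed

subsection \<open>Neighbourhoods in the boundary\<close>

lemma boundary_nbhdD:
  assumes "\<xi> \<in> gromov_boundary" "\<eta> \<in> boundary_nbhd (w :: 'x) r \<xi>"
  shows "\<not> gromov_le w \<xi> \<eta> C \<or> r \<le> C + 2 * \<delta>"
proof (rule ccontr)
  assume "\<not> ?thesis"
  then have le: "gromov_le w \<xi> \<eta> C" and r: "C + 2 * \<delta> < r" by auto
  obtain s t N where st: "s \<in> \<xi>" "t \<in> \<eta>" "\<And>i j. N \<le> i \<Longrightarrow> N \<le> j \<Longrightarrow> r \<le> gromov_product w (s i) (t j)"
    using assms(2) unfolding boundary_nbhd_def eventually_prod_sequentially by fastforce
  moreover have "\<eta> \<in> gromov_boundary" using assms(2) unfolding boundary_nbhd_def by blast
  ultimately obtain M where M: "\<forall>i\<ge>M. \<forall>j\<ge>M. gromov_product w (s i) (t j) \<le> C + 2 * \<delta>"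
    using gromov_le_eventually[OF le] coherent_boundary assms(1) by blast
  show False
    using st(3)[of "max M N" "max M N"] M[rule_format, of "max M N" "max M N"] r by simp
qed

text \<open>Of the two sides offered by \<open>gromov_le_split\<close>, the one between
  \<open>\<zeta>\<close> and \<open>\<zeta>'\<close> is excluded because their product is
  large.\<close>

lemma gromov_le_boundary_nbhd:
  assumes "\<zeta> \<in> gromov_boundary" "\<zeta>' \<in> boundary_nbhd (w :: 'x) r \<zeta>"
    and "gromov_le w \<xi> \<zeta> C" "C + 3 * \<delta> < r"
  shows "gromov_le w \<xi> \<zeta>' (C + \<delta>)"
proof -
  have "\<zeta>' \<in> gromov_boundary" using assms(2) unfolding boundary_nbhd_def by blast
  then have "\<zeta>' \<noteq> {}" using boundary_nonempty by blast
  then show ?thesis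
    using gromov_le_split[OF assms(3), of \<zeta>'] boundary_nbhdD[OF assms(1,2), of "C + \<delta>"] assms(4)
      gromov_le_commute by fastforce
qed

lemma boundary_nbhd_trans:
  assumes "\<zeta>' \<in> gromov_boundary" "\<zeta>' \<in> boundary_nbhd (w :: 'x) (r + 2 * \<delta>) \<zeta>"
    and "\<eta> \<in> boundary_nbhd w (r + 2 * \<delta>) \<zeta>'"
  shows "\<eta> \<in> boundary_nbhd w r \<zeta>"
proof -
  obtain s t N where st: "s \<in> \<zeta>" "t \<in> \<zeta>'"
    "\<And>i j. N \<le> i \<Longrightarrow> N \<le> j \<Longrightarrow> r + 2 * \<delta> \<le> gromov_product w (s i) (t j)"
    using assms(2) unfolding boundary_nbhd_def eventually_prod_sequentially by fastforce
  obtain t' u M where tu: "t' \<in> \<zeta>'" "u \<in> \<eta>"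
    "\<And>i j. M \<le> i \<Longrightarrow> M \<le> j \<Longrightarrow> r + 2 * \<delta> \<le> gromov_product w (t' i) (u j)"
    using assms(3) unfolding boundary_nbhd_def eventually_prod_sequentially by fastforce
  obtain L where L: "\<forall>i\<ge>L. \<forall>j\<ge>L. r + 2 * \<delta> \<le> gromov_product w (t i) (t' j)"
    using boundary_rel_in_boundary[OF assms(1) st(2) tu(1)] boundary_rel_iff[of t t' w] by blast
  let ?n = "max L (max M N)"
  have "r \<le> gromov_product w (s i) (u j)" if "?n \<le> i" "?n \<le> j" for i j
  proof -
    have "r + 2 * \<delta> \<le> gromov_product w (s i) (t ?n)" using st(3) that by simp
    moreover have "r + 2 * \<delta> \<le> gromov_product w (t' ?n) (u j)" using tu(3) that by simp
    moreover have "r + 2 * \<delta> \<le> gromov_product w (t ?n) (t' ?n)" using L by simp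
    ultimately show ?thesis
      using gromov_chain3[of w "s i" "t ?n" "t' ?n" "u j"] by linarith
  qed
  then have "\<forall>\<^sub>F (i, j) in sequentially \<times>\<^sub>F sequentially. r \<le> gromov_product w (s i) (u j)"
    unfolding eventually_prod_sequentially by (intro exI[of _ ?n]) simp
  then show ?thesis
    using assms(3) st(1) tu(2) unfolding boundary_nbhd_def by blast
qed

lemma self_in_boundary_nbhd:
  assumes "\<zeta> \<in> gromov_boundary" shows "\<zeta> \<in> boundary_nbhd (w :: 'x) r \<zeta>"
proof -
  obtain s where s: "s \<in> \<zeta>" using boundary_nonempty[OF assms] .
  obtain N where "\<forall>i\<ge>N. \<forall>j\<ge>N. r \<le> gromov_product w (s i) (s j)"
    using boundary_rel_in_boundary[OF assms s s] boundary_rel_iff[of s s w] by blast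
  then show ?thesis
    using assms s unfolding boundary_nbhd_def eventually_prod_sequentially by blast
qed

text \<open>The sets \<open>boundary_nbhd\<close> need not be open, so limits and compactness are
  handled through interiors; \<open>boundary_nbhd_trans\<close> plays the role of the triangle
  inequality.\<close>

lemma openin_boundary_interior:
  fixes N :: "(nat \<Rightarrow> 'x) set set"
  shows "openin boundary_topology {\<zeta> \<in> gromov_boundary. \<exists>r. boundary_nbhd w r \<zeta> \<subseteq> N}"
  unfolding openin_boundary_topology
proof (intro conjI ballI)
  fix \<zeta> assume "\<zeta> \<in> {\<zeta> \<in> gromov_boundary. \<exists>r. boundary_nbhd w r \<zeta> \<subseteq> N}"
  then obtain r where r: "boundary_nbhd w r \<zeta> \<subseteq> N" by blast
  have "boundary_nbhd w (r + 2 * \<delta>) \<zeta> \<subseteq> {\<zeta> \<in> gromov_boundary. \<exists>r. boundary_nbhd w r \<zeta> \<subseteq> N}"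
  proof
    fix \<zeta>' assume \<zeta>': "\<zeta>' \<in> boundary_nbhd w (r + 2 * \<delta>) \<zeta>"
    then have "\<zeta>' \<in> gromov_boundary" unfolding boundary_nbhd_def by blast
    moreover have "boundary_nbhd w (r + 2 * \<delta>) \<zeta>' \<subseteq> N"
      using boundary_nbhd_trans[OF \<open>\<zeta>' \<in> gromov_boundary\<close> \<zeta>'] r by blast
    ultimately show "\<zeta>' \<in> {\<zeta> \<in> gromov_boundary. \<exists>r. boundary_nbhd w r \<zeta> \<subseteq> N}" by blast
  qed
  then show "\<exists>v q. boundary_nbhd v q \<zeta> \<subseteq> {\<zeta> \<in> gromov_boundary. \<exists>r. boundary_nbhd w r \<zeta> \<subseteq> N}"
    by blast
qed auto

lemma limitin_boundary_nbhd:
  fixes a :: "(nat \<Rightarrow> 'x) set"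
  assumes "limitin boundary_topology f a F"
  shows "\<forall>\<^sub>F n in F. f n \<in> boundary_nbhd w r a"
proof -
  have a: "a \<in> gromov_boundary" using assms by (auto simp: limitin_def)
  have "\<forall>\<^sub>F n in F. f n \<in> {\<zeta> \<in> gromov_boundary. \<exists>r'. boundary_nbhd w r' \<zeta> \<subseteq> boundary_nbhd w r a}"
    using assms a openin_boundary_interior unfolding limitin_def by blast
  then show ?thesis
    using self_in_boundary_nbhd by (auto elim!: eventually_mono)
qed

text \<open>Lines from \<open>p\<close> to a compact set avoiding \<open>p\<close> all pass near
  \<open>w\<close>: one constant works around each point of the set, and finitely many constants
  suffice.\<close>

lemma compactin_gromov_le:
  fixes p :: "(nat \<Rightarrow> 'x) set"
  assumes K: "compactin boundary_topology K" "K \<subseteq> gromov_boundary - {p}" and p: "p \<in> gromov_boundary"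
  obtains C where "0 \<le> C" "\<And>\<eta>. \<eta> \<in> K \<Longrightarrow> gromov_le w p \<eta> C"
proof -
  define N where "N n = {\<zeta>. gromov_le w p \<zeta> (real n)}" for n :: nat
  define U where "U n = {\<zeta> \<in> gromov_boundary. \<exists>r. boundary_nbhd w r \<zeta> \<subseteq> N n}" for n :: nat
  have N_mono: "N m \<subseteq> N n" if "m \<le> n" for m n
    using that gromov_le_mono unfolding N_def by fastforce
  have "K \<subseteq> (\<Union>n. U n)"
  proof
    fix \<zeta> assume "\<zeta> \<in> K"
    then have \<zeta>: "\<zeta> \<in> gromov_boundary" "p \<noteq> \<zeta>" using K by auto
    then obtain C where C: "gromov_le w p \<zeta> C" using gromov_le_distinct[OF p] by blast
    obtain n where n: "C + \<delta> \<le> real n" using real_arch_simple by blast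
    have "boundary_nbhd w (C + 4 * \<delta>) \<zeta> \<subseteq> N n"
      using gromov_le_boundary_nbhd[OF \<zeta>(1) _ C, of _ "C + 4 * \<delta>"] delta_ge_1 n gromov_le_mono
      unfolding N_def by fastforce
    then show "\<zeta> \<in> (\<Union>n. U n)" using \<zeta> unfolding U_def by blast
  qed
  moreover have "openin boundary_topology (U n)" for n
    unfolding U_def by (rule openin_boundary_interior)
  ultimately obtain \<F> where \<F>: "finite \<F>" "\<F> \<subseteq> range U" "K \<subseteq> \<Union>\<F>"
    using K(1) unfolding compactin_def by (metis imageE)
  then obtain I where I: "finite I" "\<F> = U ` I" by (meson finite_subset_image)
  have "gromov_le w p \<eta> (real (Max (insert 0 I)))" if \<eta>: "\<eta> \<in> K" for \<eta>
  proof -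
    obtain n where n: "n \<in> I" "\<eta> \<in> U n" using \<eta> \<F>(3) I(2) by blast
    then have "\<eta> \<in> N n" using self_in_boundary_nbhd unfolding U_def by blast
    moreover have "n \<le> Max (insert 0 I)" using n I by simp
    ultimately show ?thesis using N_mono unfolding N_def by blast
  qed
  then show thesis using that[of "real (Max (insert 0 I))"] by simp
qed

subsection \<open>Busemann functions\<close>

lemma busemann_exists:
  assumes "\<xi> \<in> gromov_boundary"
  shows "\<exists>c. \<forall>s\<in>\<xi>. \<forall>\<^sub>F i in sequentially. \<bar>dist x (s i) - dist (y :: 'x) (s i) - c\<bar> \<le> 2 * \<delta>"
proof -
  obtain s where s: "s \<in> \<xi>" using boundary_nonempty[OF assms] .
  \<comment> \<open>Segments from \<open>x\<close> to \<open>a\<close> and to \<open>b\<close> run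
    together beyond the distance of \<open>y\<close>, so \<open>a\<close> and \<open>b\<close> see
    \<open>x\<close> and \<open>y\<close> alike. The bound on the product rules out the pairing with
    \<open>dist a b\<close> in the four-point inequality.\<close>
  have swap: "\<bar>(dist x a - dist y a) - (dist x b - dist y b)\<bar> \<le> 2 * \<delta>"
    if "dist x y + 2 * \<delta> \<le> gromov_product x a b" for a b
  proof -
    have "dist a b = dist x a + dist x b - 2 * gromov_product x a b"
      by (simp add: gromov_product_def dist_commute field_simps)
    then show ?thesis
      using four_point[of x a y b] four_point[of x b y a] that delta_ge_1
        dist_triangle[of x b y] dist_triangle[of x a y] by (auto simp: dist_commute)
  qed
  obtain N where N: "\<forall>i\<ge>N. \<forall>j\<ge>N. dist x y + 3 * \<delta> \<le> gromov_product x (s i) (s j)"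
    using boundary_rel_in_boundary[OF assms s s] boundary_rel_iff[of s s x] by blast
  have "\<forall>\<^sub>F i in sequentially. \<bar>dist x (t i) - dist y (t i) - (dist x (s N) - dist y (s N))\<bar> \<le> 2 * \<delta>"
    if t: "t \<in> \<xi>" for t
  proof -
    obtain M where M: "\<forall>i\<ge>M. \<forall>j\<ge>M. dist x y + 3 * \<delta> \<le> gromov_product x (t i) (s j)"
      using boundary_rel_in_boundary[OF assms t s] boundary_rel_iff[of t s x] by blast
    have "dist x y + 2 * \<delta> \<le> gromov_product x (t i) (s N)" if "M \<le> i" for i
      using M[rule_format, of i "max M N"] N[rule_format, of "max M N" N] that
        gromov_ineq[of x "t i" "s (max M N)" "s N"] by auto
    then show ?thesis
      using swap unfolding eventually_sequentially by blast
  qed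
  then show ?thesis by blast
qed

text \<open>The difference of distances need not converge, but by \<open>busemann_exists\<close> all
  sequences in \<open>\<xi>\<close> agree on it up to \<open>2 * \<delta>\<close>, and
  \<open>SOME\<close> picks such a value. It is negative when \<open>x\<close> is nearer to
  \<open>\<xi>\<close> than \<open>y\<close>, hence deeper in the horoballs there.\<close>

definition busemann :: "(nat \<Rightarrow> 'x) set \<Rightarrow> 'x \<Rightarrow> 'x \<Rightarrow> real" where
  "busemann \<xi> x y = (SOME c. \<forall>s\<in>\<xi>. \<forall>\<^sub>F i in sequentially. \<bar>dist x (s i) - dist y (s i) - c\<bar> \<le> 2 * \<delta>)"

lemma busemann_eventually:
  assumes "\<xi> \<in> gromov_boundary" "s \<in> \<xi>"
  shows "\<forall>\<^sub>F i in sequentially. \<bar>dist x (s i) - dist y (s i) - busemann \<xi> x y\<bar> \<le> 2 * \<delta>"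
  using someI_ex[OF busemann_exists[OF assms(1), of x y]] assms(2) unfolding busemann_def by blast

lemma busemann_triangle:
  assumes "\<xi> \<in> gromov_boundary"
  shows "\<bar>busemann \<xi> x z - busemann \<xi> x y - busemann \<xi> y z\<bar> \<le> 6 * \<delta>"
proof -
  obtain s where s: "s \<in> \<xi>" using boundary_nonempty[OF assms] .
  note b = busemann_eventually[OF assms s]
  obtain i where "\<bar>dist x (s i) - dist y (s i) - busemann \<xi> x y\<bar> \<le> 2 * \<delta>"
    "\<bar>dist y (s i) - dist z (s i) - busemann \<xi> y z\<bar> \<le> 2 * \<delta>"
    "\<bar>dist x (s i) - dist z (s i) - busemann \<xi> x z\<bar> \<le> 2 * \<delta>"
    using eventually_happens'[OF sequentially_bot
        eventually_conj[OF b[of x y] eventually_conj[OF b[of y z] b[of x z]]]] by blast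
  then show ?thesis by linarith
qed

lemma busemann_le_dist:
  assumes "\<xi> \<in> gromov_boundary" shows "\<bar>busemann \<xi> x y\<bar> \<le> dist x y + 2 * \<delta>"
proof -
  obtain s where s: "s \<in> \<xi>" using boundary_nonempty[OF assms] .
  obtain i where "\<bar>dist x (s i) - dist y (s i) - busemann \<xi> x y\<bar> \<le> 2 * \<delta>"
    using eventually_happens'[OF sequentially_bot busemann_eventually[OF assms s, of x y]] by blast
  then show ?thesis
    using dist_triangle[of x "s i" y] dist_triangle3[of y "s i" x] by (auto simp: dist_commute)
qed

lemma busemann_swap:
  assumes "\<xi> \<in> gromov_boundary" shows "\<bar>busemann \<xi> x y + busemann \<xi> y x\<bar> \<le> 8 * \<delta>"
  using busemann_triangle[OF assms, of x x y] busemann_le_dist[OF assms, of x x] by simp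

lemma busemann_push:
  assumes "isometry g" "\<xi> \<in> gromov_boundary" "push g \<xi> \<in> gromov_boundary"
  shows "\<bar>busemann (push g \<xi>) (g x) (g y) - busemann \<xi> x y\<bar> \<le> 4 * \<delta>"
proof -
  obtain s where s: "s \<in> \<xi>" using boundary_nonempty[OF assms(2)] .
  obtain i where "\<bar>dist x (s i) - dist y (s i) - busemann \<xi> x y\<bar> \<le> 2 * \<delta>"
    "\<bar>dist (g x) ((g \<circ> s) i) - dist (g y) ((g \<circ> s) i) - busemann (push g \<xi>) (g x) (g y)\<bar> \<le> 2 * \<delta>"
    using eventually_happens'[OF sequentially_bot eventually_conj[OF
        busemann_eventually[OF assms(2) s] busemann_eventually[OF assms(3) comp_in_push[OF s]]]]
    by blast
  then show ?thesis by (simp add: isometryD[OF assms(1)])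
qed

text \<open>Along the line from \<open>\<xi>\<close> to \<open>\<eta>\<close> the Busemann function
  of one end is a coarse arc length.\<close>

lemma dist_le_busemann:
  assumes \<xi>: "\<xi> \<in> gromov_boundary" "\<eta> \<in> gromov_boundary"
    and le: "gromov_le x \<xi> \<eta> C" "gromov_le y \<xi> \<eta> C"
  shows "dist x y \<le> \<bar>busemann \<xi> x y\<bar> + 2 * C + 8 * \<delta>"
proof -
  obtain s t where s: "s \<in> \<xi>" and t: "t \<in> \<eta>" using boundary_nonempty \<xi> by metis
  obtain N where N: "\<forall>i\<ge>N. \<forall>j\<ge>N. gromov_product x (s i) (t j) \<le> C + 2 * \<delta>"
    using gromov_le_eventually[OF le(1) _ _ s t] coherent_boundary \<xi> by blast
  obtain M where M: "\<forall>i\<ge>M. \<forall>j\<ge>M. gromov_product y (s i) (t j) \<le> C + 2 * \<delta>"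
    using gromov_le_eventually[OF le(2) _ _ s t] coherent_boundary \<xi> by blast
  obtain i where i: "\<bar>dist x (s i) - dist y (s i) - busemann \<xi> x y\<bar> \<le> 2 * \<delta>" "max M N \<le> i"
    using eventually_happens'[OF sequentially_bot eventually_conj[OF
        busemann_eventually[OF \<xi>(1) s] eventually_ge_at_top]] by blast
  have "gromov_product x (s i) (t i) \<le> C + 2 * \<delta>" "gromov_product y (s i) (t i) \<le> C + 2 * \<delta>"
    using N M i by auto
  then have "dist x (s i) + dist x (t i) \<le> dist (s i) (t i) + 2 * C + 4 * \<delta>"
    "dist y (s i) + dist y (t i) \<le> dist (s i) (t i) + 2 * C + 4 * \<delta>"
    by (auto simp: gromov_product_def dist_commute field_simps)
  then show ?thesis
    using i four_point[of x y "s i" "t i"] by (auto simp: dist_commute)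
qed

text \<open>By the triangle inequality through \<open>x\<close>, the sum of the Busemann functions
  of two ends is coarsely least on the line between them; no point is much deeper at both ends than
  a point of the line.\<close>

lemma busemann_line_lower:
  assumes \<xi>: "\<xi> \<in> gromov_boundary" "\<eta> \<in> gromov_boundary" and le: "gromov_le y \<xi> \<eta> C"
  shows "- 2 * C - 8 * \<delta> \<le> busemann \<xi> x y + busemann \<eta> x y"
proof -
  obtain s t where s: "s \<in> \<xi>" and t: "t \<in> \<eta>" using boundary_nonempty \<xi> by metis
  obtain N where N: "\<forall>i\<ge>N. \<forall>j\<ge>N. gromov_product y (s i) (t j) \<le> C + 2 * \<delta>"
    using gromov_le_eventually[OF le _ _ s t] coherent_boundary \<xi> by blast
  obtain i where i: "\<bar>dist x (s i) - dist y (s i) - busemann \<xi> x y\<bar> \<le> 2 * \<delta>"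
      "\<bar>dist x (t i) - dist y (t i) - busemann \<eta> x y\<bar> \<le> 2 * \<delta>" "N \<le> i"
    using eventually_happens'[OF sequentially_bot eventually_conj[OF
        busemann_eventually[OF \<xi>(1) s] eventually_conj[OF
        busemann_eventually[OF \<xi>(2) t] eventually_ge_at_top]]] by blast
  have "gromov_product y (s i) (t i) \<le> C + 2 * \<delta>" using N i by auto
  then show ?thesis
    using i dist_triangle3[of "s i" "t i" x]
    by (simp add: gromov_product_def dist_commute field_simps)
qed

text \<open>Here \<open>w\<close> is a centre of the ideal triangle \<open>p\<close>, \<open>x\<close>, \<open>x'\<close>, so a point on both sides through
  \<open>p\<close> and far from \<open>w\<close> lies in the direction of \<open>p\<close>.\<close>

lemma busemann_tripod:
  assumes p: "p \<in> gromov_boundary" "x \<in> gromov_boundary" "x' \<in> gromov_boundary"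
    and w: "gromov_le w p x C" "gromov_le w p x' C" "gromov_le w x x' C"
    and y: "gromov_le y p x C" "gromov_le y p x' C"
    and far: "5 * C + 16 * \<delta> < dist y w"
  shows "busemann p y w \<le> 2 * C + 8 * \<delta> - dist y w"
proof -
  obtain s t t' where s: "s \<in> p" and t: "t \<in> x" and t': "t' \<in> x'"
    using boundary_nonempty p by metis
  note ev = gromov_le_eventually[OF _ coherent_boundary coherent_boundary]
  obtain N1 where N1: "\<forall>i\<ge>N1. \<forall>j\<ge>N1. gromov_product w (t i) (t' j) \<le> C + 2 * \<delta>"
    using ev[OF w(3) p(2,3) t t'] by blast
  obtain N2 where N2: "\<forall>i\<ge>N2. \<forall>j\<ge>N2. gromov_product y (s i) (t j) \<le> C + 2 * \<delta>"
    using ev[OF y(1) p(1,2) s t] by blast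
  obtain N3 where N3: "\<forall>i\<ge>N3. \<forall>j\<ge>N3. gromov_product y (s i) (t' j) \<le> C + 2 * \<delta>"
    using ev[OF y(2) p(1,3) s t'] by blast
  obtain i where i: "\<bar>dist y (s i) - dist w (s i) - busemann p y w\<bar> \<le> 2 * \<delta>" "max N1 (max N2 N3) \<le> i"
    using eventually_happens'[OF sequentially_bot eventually_conj[OF
        busemann_eventually[OF p(1) s] eventually_ge_at_top]] by blast
  have 1: "gromov_product w (t i) (t' i) \<le> C + 2 * \<delta>"
      "gromov_product y (s i) (t i) \<le> C + 2 * \<delta>" "gromov_product y (s i) (t' i) \<le> C + 2 * \<delta>"
    using N1 N2 N3 i by auto
  have line: "dist y w \<le> \<bar>busemann p y w\<bar> + 2 * C + 8 * \<delta>"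
    by (rule dist_le_busemann[OF p(1,2) y(1) w(1)])
  have "busemann p y w < 0"
  proof (rule ccontr)
    assume "\<not> busemann p y w < 0"
    then have D: "dist w (s i) + dist y w \<le> dist y (s i) + 2 * C + 10 * \<delta>"
      using line i by linarith
    \<comment> \<open>The three inequalities add up to
      \<open>dist y (s i) - dist w (s i) \<le> 3 * C + 6 * \<delta>\<close>; with \<open>D\<close>
      this bounds \<open>dist y w\<close> by the threshold in \<open>far\<close>.\<close>
    have "dist y (t i) + dist y (s i) \<le> dist w (s i) + dist w (t i) + 2 * C + 4 * \<delta>"
      using 1(2) dist_triangle[of "s i" "t i" w]
      unfolding gromov_product_def by (simp add: dist_commute field_simps)
    moreover have "dist y (t' i) + dist y (s i) \<le> dist w (s i) + dist w (t' i) + 2 * C + 4 * \<delta>"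
      using 1(3) dist_triangle[of "s i" "t' i" w]
      unfolding gromov_product_def by (simp add: dist_commute field_simps)
    moreover have "dist w (t i) + dist w (t' i) \<le> dist y (t i) + dist y (t' i) + 2 * C + 4 * \<delta>"
      using 1(1) dist_triangle[of "t i" "t' i" y]
      unfolding gromov_product_def by (simp add: dist_commute field_simps)
    ultimately show False using D far by linarith
  qed
  then show ?thesis using line by linarith
qed

subsection \<open>Isometries translating towards a boundary point\<close>

text \<open>\<open>E n = d(g\<^sup>n w, w) - b(g\<^sup>n w, w)\<close> is about twice the Gromov product of \<open>g\<^sup>n w\<close> and \<open>p\<close>; as
  \<open>g\<close> moves points away from \<open>p\<close>, the four-point inequality bounds it by \<open>E 1\<close>.\<close>

lemma translation_two_fixed_points:
  fixes g :: "'x \<Rightarrow> 'x"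
  assumes g: "isometry g" and push_in: "\<And>\<xi>. \<xi> \<in> gromov_boundary \<Longrightarrow> push g \<xi> \<in> gromov_boundary"
    and p: "p \<in> gromov_boundary" "push g p = p" and shift: "20 * \<delta> \<le> busemann p (g w) w"
    and subseq: "\<And>u. filterlim (\<lambda>n. dist (u n :: 'x) w) at_top sequentially \<Longrightarrow>
      \<exists>r. strict_mono (r :: nat \<Rightarrow> nat) \<and> u \<circ> r \<in> gromov_sequences"
  shows "filterlim (\<lambda>n. dist ((g ^^ n) w) w) at_top sequentially"
    and "\<exists>q. q \<noteq> p \<and> {\<xi> \<in> gromov_boundary. push g \<xi> = \<xi>} = {p, q}"
proof -
  define y where "y n = (g ^^ n) w" for n
  have y_Suc: "y (Suc n) = g (y n)" for n by (simp add: y_def)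
  have y0: "y 0 = w" by (simp add: y_def)
  let ?b = "busemann p"
  have b_g: "\<bar>?b (g a) (g c) - ?b a c\<bar> \<le> 4 * \<delta>" for a c
    using busemann_push[OF g p(1), of a c] p by simp
  \<comment> \<open>Each step gains at least
    \<open>20 * \<delta> - 6 * \<delta> - 4 * \<delta>\<close>, after the errors of
    \<open>busemann_triangle\<close> and \<open>b_g\<close>, and this exceeds
    \<open>1\<close>.\<close>
  have b_y: "real n - 2 * \<delta> \<le> ?b (y n) w" for n
  proof (induction n)
    case 0
    then show ?case using busemann_le_dist[OF p(1), of w w] by (simp add: y0)
  next
    case (Suc n)
    then show ?case
      using busemann_triangle[OF p(1), of "y (Suc n)" w "g w"] b_g[of "y n" w] shift delta_ge_1
      by (simp add: y_Suc)
  qed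
  have dist_y: "real n - 4 * \<delta> \<le> dist (y n) w" for n
    using b_y[of n] busemann_le_dist[OF p(1), of "y n" w] by linarith
  show lim: "filterlim (\<lambda>n. dist ((g ^^ n) w) w) at_top sequentially"
  proof (rule filterlim_at_top_mono)
    show "filterlim (\<lambda>n. real n - 4 * \<delta>) at_top sequentially"
      using filterlim_tendsto_add_at_top[OF tendsto_const[of "- 4 * \<delta>"] filterlim_real_sequentially]
      by (simp add: add.commute)
  qed (use dist_y in \<open>simp add: y_def\<close>)
  define E where "E x = dist x w - ?b x w" for x
  obtain s where s: "s \<in> p" using boundary_nonempty[OF p(1)] .
  note b_ev = busemann_eventually[OF p(1) s]
  \<comment> \<open>Up to errors, one alternative of the four-point inequality bounds
    \<open>E (g x)\<close> by \<open>E (g w)\<close>, the other by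
    \<open>E x - 2 * ?b (g w) w\<close>, where \<open>shift\<close> absorbs the errors.\<close>
  have E_step: "E (g x) \<le> max (E (g w) + 10 * \<delta>) (E x)" for x
  proof -
    obtain i where i: "\<bar>dist (g x) (s i) - dist w (s i) - ?b (g x) w\<bar> \<le> 2 * \<delta>"
        "\<bar>dist (g w) (s i) - dist w (s i) - ?b (g w) w\<bar> \<le> 2 * \<delta>"
        "\<bar>dist (g x) (s i) - dist (g w) (s i) - ?b (g x) (g w)\<bar> \<le> 2 * \<delta>"
      using eventually_happens'[OF sequentially_bot eventually_conj[OF b_ev[of "g x" w]
            eventually_conj[OF b_ev[of "g w" w] b_ev[of "g x" "g w"]]]] by blast
    have "dist (g x) w + dist (g w) (s i)
        \<le> max (dist (g x) (g w) + dist w (s i)) (dist (g x) (s i) + dist w (g w)) + 2 * \<delta>"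
      using four_point[of "g x" w "g w" "s i"] by (simp add: dist_commute)
    then show ?thesis
      using i b_g[of x w] shift isometryD[OF g, of x w]
      unfolding E_def by (auto simp: max_def dist_commute split: if_splits)
  qed
  define E0 where "E0 = max (E (g w) + 10 * \<delta>) (E w)"
  have E_y: "E (y n) \<le> E0" for n
  proof (induction n)
    case 0
    then show ?case by (simp add: y0 E0_def)
  next
    case (Suc n)
    then show ?case using E_step[of "y n"] unfolding y_Suc E0_def by linarith
  qed
  have y_p: "\<forall>\<^sub>F j in sequentially. 2 * gromov_product w (y n) (s j) \<le> E0 + 2 * \<delta>" for n
    using b_ev[of "y n" w]
  proof eventually_elim
    case (elim j)
    then show ?case using E_y[of n] unfolding E_def gromov_product_def by (simp add: dist_commute)
  qed
  obtain r where r: "strict_mono r" "y \<circ> r \<in> gromov_sequences"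
    using subseq[of y] lim unfolding y_def by blast
  then obtain q where q: "q \<in> gromov_boundary" "y \<circ> r \<in> q"
    using gromov_sequence_in_boundary by blast
  have "q \<noteq> p"
  proof
    assume "q = p"
    then have "boundary_rel (y \<circ> r) s"
      using boundary_rel_in_boundary[OF p(1)] q s by blast
    then obtain N where N: "\<forall>i\<ge>N. \<forall>j\<ge>N. E0 / 2 + 2 * \<delta> \<le> gromov_product w ((y \<circ> r) i) (s j)"
      unfolding boundary_rel_iff[where w = w] by blast
    obtain j where "2 * gromov_product w (y (r N)) (s j) \<le> E0 + 2 * \<delta>" "N \<le> j"
      using eventually_happens'[OF sequentially_bot eventually_conj[OF y_p eventually_ge_at_top]]
      by blast
    then show False using N[rule_format, of N j] delta_ge_1 by simp
  qed
  moreover have "push g q = q"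
  proof -
    have "dist (y n) (g (y n)) \<le> dist w (g w)" for n
      by (induction n) (simp_all add: y0 y_Suc isometryD[OF g])
    then have "boundary_rel (y \<circ> r) (g \<circ> (y \<circ> r))"
      by (intro boundary_rel_bounded_dist[OF boundary_rel_in_boundary[OF q(1) q(2) q(2)]]) simp
    then show ?thesis
      using boundary_eqI[OF q(1) push_in[OF q(1)] q(2) comp_in_push[OF q(2)]] by simp
  qed
  \<comment> \<open>If there were a third fixed point \<open>z\<close>, the orbit of
    \<open>w\<close> would stay near the line from \<open>p\<close> to \<open>z\<close>, while its
    products at \<open>w\<close> with \<open>p\<close> and, along \<open>r\<close>, with
    \<open>z\<close> are bounded. Together this would bound \<open>dist (y (r n)) w\<close>.\<close>
  moreover have "z = p \<or> z = q" if z: "z \<in> gromov_boundary" "push g z = z" for z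
  proof (rule ccontr)
    assume "\<not> (z = p \<or> z = q)"
    then obtain C1 C2 where C1: "gromov_le w p z C1" and C2: "gromov_le w q z C2"
      using gromov_le_distinct[OF p(1) z(1)] gromov_le_distinct[OF q(1) z(1)] by metis
    have C1_y: "gromov_le (y n) p z C1" for n
    proof (induction n)
      case (Suc n)
      then show ?case using gromov_le_push[OF g Suc] p z by (simp add: y_Suc)
    qed (simp add: y0 C1)
    obtain t where t: "t \<in> z" using boundary_nonempty[OF z(1)] .
    note ev = gromov_le_eventually[OF _ coherent_boundary coherent_boundary]
    obtain N where N: "\<forall>i\<ge>N. \<forall>j\<ge>N. gromov_product w ((y \<circ> r) i) (t j) \<le> C2 + 2 * \<delta>"
      using ev[OF C2 q(1) z(1) q(2) t] by blast
    obtain n where n: "N \<le> n" "E0 + 2 * C1 + 2 * C2 + 20 * \<delta> < real n"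
    proof -
      obtain n where "E0 + 2 * C1 + 2 * C2 + 20 * \<delta> < real n" using reals_Archimedean2 by blast
      then show thesis by (intro that[of "max N n"]) auto
    qed
    let ?y = "y (r n)"
    obtain M where M: "\<forall>i\<ge>M. \<forall>j\<ge>M. gromov_product ?y (s i) (t j) \<le> C1 + 2 * \<delta>"
      using ev[OF C1_y p(1) z(1) s t] by blast
    obtain j where j: "2 * gromov_product w ?y (s j) \<le> E0 + 2 * \<delta>" "max M N \<le> j"
      using eventually_happens'[OF sequentially_bot eventually_conj[OF y_p eventually_ge_at_top]]
      by blast
    have "gromov_product ?y (s j) (t j) \<le> C1 + 2 * \<delta>" "gromov_product w ?y (t j) \<le> C2 + 2 * \<delta>"
      using M N j n by auto
    moreover have "real n - 4 * \<delta> \<le> dist ?y w"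
      using dist_y[of "r n"] seq_suble[OF r(1), of n] by linarith
    ultimately show False
      using j(1) n(2) dist_triangle[of "s j" "t j" w] delta_ge_1
      unfolding gromov_product_def by (simp add: dist_commute field_simps)
  qed
  ultimately show "\<exists>q. q \<noteq> p \<and> {\<xi> \<in> gromov_boundary. push g \<xi> = \<xi>} = {p, q}"
    using p q by (intro exI[of _ q]) auto
qed

text \<open>Both \<open>y\<close> and its image \<open>k y\<close> are close to the ray from \<open>w\<close> to the fixed point \<open>p\<close> and about
  equally deep.\<close>

lemma parabolic_displacement:
  assumes k: "isometry k" "push k p = p" and p: "p \<in> gromov_boundary"
    and shift: "\<bar>busemann p (k w) w\<bar> \<le> 40 * \<delta>"
    and ray: "dist y w \<le> D - busemann p y w" and deep: "dist w (k w) + 6 * \<delta> \<le> - 2 * busemann p y w"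
    and D: "0 \<le> D"
  shows "dist (k y) y \<le> D + 60 * \<delta>"
proof -
  obtain s where s: "s \<in> p" using boundary_nonempty[OF p] .
  note ev = busemann_eventually[OF p s]
  obtain i where i: "\<bar>dist (k y) (s i) - dist (k w) (s i) - busemann p (k y) (k w)\<bar> \<le> 2 * \<delta>"
      "\<bar>dist (k w) (s i) - dist w (s i) - busemann p (k w) w\<bar> \<le> 2 * \<delta>"
      "\<bar>dist y (s i) - dist w (s i) - busemann p y w\<bar> \<le> 2 * \<delta>"
    using eventually_happens'[OF sequentially_bot eventually_conj[OF ev[of "k y" "k w"]
          eventually_conj[OF ev[of "k w" w] ev[of y w]]]] by blast
  have "\<bar>busemann p (k y) (k w) - busemann p y w\<bar> \<le> 4 * \<delta>"
    using busemann_push[OF k(1) p, of y w] p k by simp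
  moreover have "dist (k y) (k w) = dist y w" by (rule isometryD[OF k(1)])
  moreover have "dist (k y) w + dist (k w) (s i)
      \<le> max (dist (k y) (k w) + dist w (s i)) (dist (k y) (s i) + dist w (k w)) + 2 * \<delta>"
    using four_point[of "k y" w "k w" "s i"] by (simp add: dist_commute)
  ultimately have "dist (k y) w \<le> D - busemann p y w + 46 * \<delta>"
    using i shift ray deep D delta_ge_1 by linarith
  moreover have "dist (k y) y + dist w (s i)
      \<le> max (dist (k y) w + dist y (s i)) (dist (k y) (s i) + dist y w) + 2 * \<delta>"
    using four_point[of "k y" y w "s i"] by (simp add: dist_commute)
  ultimately show ?thesis
    using i shift ray \<open>\<bar>busemann p (k y) (k w) - busemann p y w\<bar> \<le> 4 * \<delta>\<close> delta_ge_1 by linarith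
qed

subsection \<open>The hull of the boundary\<close>

definition boundary_hull :: "real \<Rightarrow> 'x set" where
  "boundary_hull C = {x. \<exists>\<xi>\<in>gromov_boundary. \<exists>\<eta>\<in>gromov_boundary. gromov_le x \<xi> \<eta> C}"

text \<open>Prolong the segment from \<open>x\<close> to \<open>y\<close> at both ends to boundary
  points \<open>a\<close> and \<open>b\<close>. A point \<open>z\<close> of it far from both ends
  lies near the line from \<open>a\<close> to \<open>b\<close> with constant
  \<open>2 * \<delta> + 1\<close>, so \<open>C\<close> does not deteriorate; otherwise an end of the
  segment replaces \<open>z\<close>.\<close>

lemma rough_geodesic_boundary_hull:
  assumes UNIV: "rough_geodesic 1 (UNIV :: 'x set)" and C: "2 * \<delta> + 1 \<le> C"
  shows "rough_geodesic (C + 8 * \<delta>) (boundary_hull C)"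
  unfolding rough_geodesic_def
proof (intro ballI allI impI)
  fix x y t
  assume x: "x \<in> boundary_hull C" and y: "y \<in> boundary_hull C" and t: "0 \<le> t \<and> t \<le> dist x y"
  let ?\<kappa> = "C + 8 * \<delta>"
  obtain z where z: "dist x z \<le> t + 1" "dist z y \<le> dist x y - t + 1"
    using UNIV t unfolding rough_geodesic_def by blast
  \<comment> \<open>A line through \<open>u\<close> is split at \<open>v\<close>; one of the two
    parts still passes near \<open>u\<close>, which therefore lies between \<open>v\<close> and an
    end of the line.\<close>
  have away: "\<exists>a\<in>gromov_boundary. gromov_le u a {\<lambda>_. v} (C + \<delta>)" if "u \<in> boundary_hull C" for u v
    using that gromov_le_split[of u _ _ C "{\<lambda>_. v}"] gromov_le_commute
    unfolding boundary_hull_def by blast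
  obtain a where a: "a \<in> gromov_boundary" "gromov_le x a {\<lambda>_. y} (C + \<delta>)" using away[OF x] by blast
  obtain b where b: "b \<in> gromov_boundary" "gromov_le y b {\<lambda>_. x} (C + \<delta>)" using away[OF y] by blast
  obtain s where s: "s \<in> a" using boundary_nonempty[OF a(1)] .
  obtain s' where s': "s' \<in> b" using boundary_nonempty[OF b(1)] .
  obtain N where N: "\<forall>i\<ge>N. \<forall>j\<ge>N. gromov_product x (s i) y \<le> C + \<delta> + 2 * \<delta>"
    using gromov_le_eventually[OF a(2) coherent_boundary[OF a(1)] coherent_point s] by blast
  obtain M where M: "\<forall>i\<ge>M. \<forall>j\<ge>M. gromov_product y (s' i) x \<le> C + \<delta> + 2 * \<delta>"
    using gromov_le_eventually[OF b(2) coherent_boundary[OF b(1)] coherent_point s'] by blast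
  show "\<exists>z\<in>boundary_hull C. dist x z \<le> t + ?\<kappa> \<and> dist z y \<le> dist x y - t + ?\<kappa>"
  proof (cases "dist x z \<le> C + 7 * \<delta> \<or> dist z y \<le> C + 7 * \<delta>")
    case True
    then show ?thesis
    proof
      assume "dist x z \<le> C + 7 * \<delta>"
      then show ?thesis
        using x t z C delta_ge_1 dist_triangle[of x y z] by (intro bexI[of _ x]) auto
    next
      assume "dist z y \<le> C + 7 * \<delta>"
      then show ?thesis
        using y t z C delta_ge_1 dist_triangle[of x y z] by (intro bexI[of _ y]) auto
    qed
  next
    case False
    have "gromov_product z (s i) (s' j) \<le> C" if "max M N \<le> i" "max M N \<le> j" for i j
    proof -
      have A: "gromov_product x (s i) y \<le> C + 3 * \<delta>" and B: "gromov_product y (s' j) x \<le> C + 3 * \<delta>"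
        using N M that by auto
      have "gromov_product z x y \<le> 1"
        using z unfolding gromov_product_def by (simp add: dist_commute)
      moreover have "gromov_product z x (s i) > 1 + 2 * \<delta>"
        using A False z dist_triangle2[of "s i" y z] delta_ge_1
        unfolding gromov_product_def by (simp add: dist_commute field_simps)
      moreover have "gromov_product z (s' j) y > 1 + 2 * \<delta>"
        using B False z dist_triangle2[of "s' j" x z] delta_ge_1
        unfolding gromov_product_def by (simp add: dist_commute field_simps)
      ultimately show ?thesis
        using gromov_chain3[of z x "s i" "s' j" y] C by linarith
    qed
    then have "gromov_le z a b C"
      unfolding gromov_le_def using s s' by (meson max.cobounded1 max.cobounded2 linear)
    then have "z \<in> boundary_hull C"
      using a b unfolding boundary_hull_def by blast
    then show ?thesis using z C delta_ge_1 by (intro bexI[of _ z]) auto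
  qed
qed

end

subsection \<open>Proper path metric spaces\<close>

lemma path_metric_space_between:
  fixes x y :: "'x::metric_space"
  assumes "path_metric_space TYPE('x)" "0 \<le> t" "t \<le> dist x y" "0 < \<epsilon>"
  obtains z where "dist x z = t" "dist z y \<le> dist x y - t + \<epsilon>"
proof -
  let ?P = "{p. path p \<and> pathstart p = x \<and> pathfinish p = y}"
  have "(INF p \<in> ?P. path_length p) < ennreal (dist x y + \<epsilon>)"
  proof -
    have "(INF p \<in> ?P. path_length p) = ennreal (dist x y)"
      using assms(1) unfolding path_metric_space_def by simp
    also have "\<dots> < ennreal (dist x y + \<epsilon>)"
      using assms(4) by (intro ennreal_lessI) (auto intro: add_nonneg_pos)
    finally show ?thesis .
  qed
  then obtain p where p: "path p" "pathstart p = x" "pathfinish p = y"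
      and len: "path_length p < ennreal (dist x y + \<epsilon>)"
    unfolding INF_less_iff by blast
  have "continuous_on {0..1} (\<lambda>u. dist x (p u))"
    using p(1) unfolding path_def by (intro continuous_intros)
  then obtain u where u: "0 \<le> u" "u \<le> 1" "dist x (p u) = t"
    using IVT'[of "\<lambda>u. dist x (p u)" 0 t 1] p assms(2,3) by (auto simp: pathstart_def pathfinish_def)
  have "ennreal (dist x (p u) + dist (p u) y)
      = (\<Sum>i<length [0, u, 1] - 1. ennreal (dist (p ([0, u, 1] ! i)) (p ([0, u, 1] ! Suc i))))"
    using p by (simp add: pathstart_def pathfinish_def numeral_2_eq_2 ennreal_plus)
  also have "\<dots> \<le> path_length p"
    unfolding path_length_def using u by (intro SUP_upper) auto
  finally have "ennreal (dist x (p u) + dist (p u) y) < ennreal (dist x y + \<epsilon>)"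
    using len by order
  then have "dist x (p u) + dist (p u) y < dist x y + \<epsilon>"
    by (subst (asm) ennreal_less_iff) auto
  then show thesis using u by (intro that[of "p u"]) auto
qed

text \<open>For each radius \<open>n\<close>, the points at distance \<open>n\<close> from
  \<open>w\<close> on near-shortest paths to the \<open>u i\<close> subconverge by properness, so
  later paths share their course up to there. A diagonal sequence achieves this for every
  \<open>n\<close>.\<close>

lemma gromov_subsequence:
  fixes u :: "nat \<Rightarrow> 'x::metric_space"
  assumes proper: "proper_space TYPE('x)" and path: "path_metric_space TYPE('x)"
    and lim: "filterlim (\<lambda>n. dist (u n) w) at_top sequentially"
  obtains r where "strict_mono (r :: nat \<Rightarrow> nat)" "u \<circ> r \<in> gromov_sequences"
proof -
  \<comment> \<open>The loss of \<open>2\<close> is half of the sum of the slack \<open>1\<close> in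
    each of two paths and the distance below \<open>2\<close> between the two chosen points.\<close>
  define P where "P n r \<longleftrightarrow> (\<exists>N. \<forall>i\<ge>N. \<forall>j\<ge>N. real n - 2 \<le> gromov_product w (u (r i)) (u (r j)))"
    for n and r :: "nat \<Rightarrow> nat"
  interpret subseqs P
  proof
    fix n and r :: "nat \<Rightarrow> nat" assume r: "strict_mono r"
    have "\<forall>\<^sub>F i in sequentially. real n \<le> dist (u i) w"
      using lim unfolding filterlim_at_top by blast
    then obtain N where N: "\<And>i. N \<le> i \<Longrightarrow> real n \<le> dist w (u i)"
      unfolding eventually_sequentially by (auto simp: dist_commute)
    have "\<exists>z. dist w z = real n \<and> dist z (u i) \<le> dist w (u i) - real n + 1" if "N \<le> i" for i
      using path_metric_space_between[OF path _ N[OF that], of 1] by (metis of_nat_0_le_iff zero_less_one)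
    then obtain z where z: "\<And>i. N \<le> i \<Longrightarrow> dist w (z i) = real n"
        "\<And>i. N \<le> i \<Longrightarrow> dist (z i) (u i) \<le> dist w (u i) - real n + 1"
      by metis
    have "seq_compact (cball w (real n))"
      using proper unfolding proper_space_def by (simp add: compact_imp_seq_compact)
    moreover have "z (r (i + N)) \<in> cball w (real n)" for i
      using z(1)[of "r (i + N)"] seq_suble[OF r, of "i + N"] by simp
    ultimately obtain l q where q: "strict_mono q" "((\<lambda>i. z (r (i + N))) \<circ> q) \<longlonglongrightarrow> l"
      unfolding seq_compact_def by metis
    then have "\<forall>\<^sub>F i in sequentially. dist (z (r (q i + N))) l < 1"
      unfolding tendsto_iff by (auto simp: o_def)
    then obtain M where M: "\<And>i. M \<le> i \<Longrightarrow> dist (z (r (q i + N))) l < 1"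
      unfolding eventually_sequentially by blast
    define r' where "r' i = q i + N" for i
    have "strict_mono r'" using q(1) unfolding r'_def strict_mono_def by simp
    moreover have "real n - 2 \<le> gromov_product w (u (r (r' i))) (u (r (r' j)))" if "M \<le> i" "M \<le> j" for i j
    proof -
      let ?i = "r (r' i)" and ?j = "r (r' j)"
      have ge: "N \<le> ?i" "N \<le> ?j"
        using seq_suble[OF r, of "r' i"] seq_suble[OF r, of "r' j"] unfolding r'_def by auto
      have "dist (z ?i) (z ?j) < 2"
        using M[OF that(1)] M[OF that(2)] dist_triangle2[of "z ?i" "z ?j" l] unfolding r'_def by simp
      then have "dist (u ?i) (u ?j) \<le> dist w (u ?i) + dist w (u ?j) - 2 * real n + 4"
        using z(2)[OF ge(1)] z(2)[OF ge(2)] dist_triangle[of "u ?i" "u ?j" "z ?i"]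
          dist_triangle[of "z ?i" "u ?j" "z ?j"] by (simp add: dist_commute)
      then show ?thesis by (simp add: gromov_product_def dist_commute)
    qed
    ultimately show "\<exists>r'. strict_mono r' \<and> P n (r \<circ> r')"
      unfolding P_def by (intro exI[of _ r']) auto
  qed
  have P_diag: "P n (diagseq \<circ> (+) (Suc n))" for n
  proof (rule diagseq_holds)
    fix r s n assume r: "strict_mono (r :: nat \<Rightarrow> nat)" and "P n s"
    then show "P n (s \<circ> r)"
      unfolding P_def using seq_suble[OF r] by (metis comp_apply order_trans)
  qed
  have "boundary_rel (u \<circ> diagseq) (u \<circ> diagseq)"
    unfolding boundary_rel_iff[where w = w]
  proof
    fix C :: real
    obtain n where n: "C + 2 \<le> real n" using real_arch_simple by blast
    obtain N where N: "\<And>i j. N \<le> i \<Longrightarrow> N \<le> j \<Longrightarrow>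
        real n - 2 \<le> gromov_product w (u (diagseq (Suc n + i))) (u (diagseq (Suc n + j)))"
      using P_diag[of n] unfolding P_def by auto
    have "C \<le> gromov_product w ((u \<circ> diagseq) i) ((u \<circ> diagseq) j)"
      if "Suc n + N \<le> i" "Suc n + N \<le> j" for i j
    proof -
      have "N \<le> i - Suc n" "N \<le> j - Suc n" using that by auto
      then show ?thesis using N[of "i - Suc n" "j - Suc n"] that n by simp
    qed
    then show "\<exists>N. \<forall>i\<ge>N. \<forall>j\<ge>N. C \<le> gromov_product w ((u \<circ> diagseq) i) ((u \<circ> diagseq) j)" by blast
  qed
  then show thesis
    using that[OF subseq_diagseq] unfolding gromov_sequences_def by blast
qed

section \<open>Actions on hyperbolic spaces\<close>

locale hyperbolic_action = hyperbolic X \<delta> + group G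
  for X :: "'x::metric_space itself" and \<delta> :: real and G :: "('g, 'm) monoid_scheme" (structure) +
  fixes \<phi> :: "'g \<Rightarrow> 'x \<Rightarrow> 'x"
  assumes proper: "proper_space TYPE('x)" and path_metric: "path_metric_space TYPE('x)"
    and isometric: "isometric_action G \<phi>"
    and discontinuous: "properly_discontinuous G euclidean \<phi>"
    and boundary_group_action: "group_action G gromov_boundary (boundary_action \<phi>)"
begin

section \<open>Elementary facts on the actions on the space and its boundary\<close>

lemma isometry_action: "g \<in> carrier G \<Longrightarrow> isometry (\<phi> g)"
  using isometric unfolding isometric_action_def isometry_def by blast

lemma action_mult: "g \<in> carrier G \<Longrightarrow> h \<in> carrier G \<Longrightarrow> \<phi> (g \<otimes> h) = \<phi> g \<circ> \<phi> h"
  using group_action.composition_rule[of G UNIV \<phi>] isometric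
  unfolding isometric_action_def by fastforce

lemma action_one: "\<phi> \<one> = id"
proof
  fix x
  have "(\<lambda>x \<in> UNIV. x) x = \<phi> \<one> x"
    using group_action.id_eq_one[of G UNIV \<phi>] isometric unfolding isometric_action_def by metis
  then show "\<phi> \<one> x = id x" by simp
qed

lemma action_inv [simp]:
  assumes "g \<in> carrier G" shows "\<phi> (inv g) (\<phi> g x) = x" "\<phi> g (\<phi> (inv g) x) = x"
  using action_mult[of "inv g" g] action_mult[of g "inv g"] action_one assms
  by (metis comp_apply id_apply inv_closed l_inv r_inv)+

lemma dist_action: "g \<in> carrier G \<Longrightarrow> dist (\<phi> g x) (\<phi> g y) = dist x y"
  by (rule isometryD[OF isometry_action])

lemma dist_action_inv: "g \<in> carrier G \<Longrightarrow> dist (\<phi> (inv g) x) y = dist x (\<phi> g y)"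
  using dist_action[of g "\<phi> (inv g) x" y] by simp

lemma boundary_action_push: "\<xi> \<in> gromov_boundary \<Longrightarrow> boundary_action \<phi> g \<xi> = push (\<phi> g) \<xi>"
  by (simp add: boundary_action_def push_def)

lemma push_in_boundary:
  assumes "g \<in> carrier G" "\<xi> \<in> gromov_boundary" shows "push (\<phi> g) \<xi> \<in> gromov_boundary"
  using group_action.element_image[OF boundary_group_action assms refl] boundary_action_push[OF assms(2)]
  by simp

lemma push_mult:
  "g \<in> carrier G \<Longrightarrow> h \<in> carrier G \<Longrightarrow> push (\<phi> (g \<otimes> h)) A = push (\<phi> g) (push (\<phi> h) A)"
  by (simp add: push_comp action_mult)

lemma push_one [simp]: "push (\<phi> \<one>) A = A"
  by (simp add: action_one push_def)

lemma push_inv [simp]: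
  assumes "g \<in> carrier G"
  shows "push (\<phi> (inv g)) (push (\<phi> g) A) = A" "push (\<phi> g) (push (\<phi> (inv g)) A) = A"
  using push_mult[of "inv g" g A] push_mult[of g "inv g" A] assms by simp_all

definition Stab :: "(nat \<Rightarrow> 'x) set \<Rightarrow> 'g set" where
  "Stab p = {g \<in> carrier G. push (\<phi> g) p = p}"

lemma stabilizer_eq_Stab: "p \<in> gromov_boundary \<Longrightarrow> stabilizer G (boundary_action \<phi>) p = Stab p"
  by (auto simp: stabilizer_def Stab_def boundary_action_push)

lemma Stab_inv: "g \<in> Stab p \<Longrightarrow> inv g \<in> Stab p"
  unfolding Stab_def by (metis (mono_tags, lifting) inv_closed mem_Collect_eq push_inv(1))

lemma Stab_mult: "g \<in> Stab p \<Longrightarrow> h \<in> Stab p \<Longrightarrow> g \<otimes> h \<in> Stab p"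
  by (auto simp: Stab_def push_mult)

lemma Stab_one: "\<one> \<in> Stab p"
  by (simp add: Stab_def)

lemma finite_ball: "finite {g \<in> carrier G. dist (\<phi> g w) w \<le> R}"
proof -
  have "compactin euclidean (cball w (max 0 R))"
    using proper unfolding proper_space_def by (simp add: compactin_euclidean_iff)
  then have "finite {g \<in> carrier G. \<phi> g ` cball w (max 0 R) \<inter> cball w (max 0 R) \<noteq> {}}"
    using discontinuous unfolding properly_discontinuous_def by blast
  moreover have "\<phi> g w \<in> \<phi> g ` cball w (max 0 R) \<inter> cball w (max 0 R)" if "dist (\<phi> g w) w \<le> R" for g
    using that by (auto simp: dist_commute)
  ultimately show ?thesis
    by (elim finite_subset[rotated]) blast
qed

lemma infinite_unbounded:
  assumes "infinite H" "H \<subseteq> carrier G" obtains h where "h \<in> H" "R < dist (\<phi> h w) w"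
proof -
  have "\<not> H \<subseteq> {g \<in> carrier G. dist (\<phi> g w) w \<le> R}"
    using finite_ball assms(1) finite_subset by blast
  then obtain h where "h \<in> H" "h \<notin> {g \<in> carrier G. dist (\<phi> g w) w \<le> R}" by blast
  then show thesis using that[of h] assms(2) by (auto simp: not_le)
qed

lemma gromov_le_action:
  assumes "g \<in> carrier G" "gromov_le x A B C" shows "gromov_le (\<phi> g x) (push (\<phi> g) A) (push (\<phi> g) B) C"
  using gromov_le_push[OF isometry_action] assms by blast

lemma boundary_hull_action:
  assumes "g \<in> carrier G" "x \<in> boundary_hull C" shows "\<phi> g x \<in> boundary_hull C"
  using assms gromov_le_action push_in_boundary unfolding boundary_hull_def by blast

lemma busemann_action:
  assumes "g \<in> carrier G" "\<xi> \<in> gromov_boundary"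
  shows "\<bar>busemann (push (\<phi> g) \<xi>) (\<phi> g x) (\<phi> g y) - busemann \<xi> x y\<bar> \<le> 4 * \<delta>"
  using busemann_push[OF isometry_action] push_in_boundary assms by blast

lemma action_pow: "g \<in> carrier G \<Longrightarrow> \<phi> (g [^] (n::nat)) = \<phi> g ^^ n"
  by (induction n) (simp_all add: action_one action_mult funpow_Suc_right del: funpow.simps(2))

abbreviation "bdry_top \<equiv> (boundary_topology :: (nat \<Rightarrow> 'x) set topology)"

lemma ex_gromov_subsequence:
  fixes u :: "nat \<Rightarrow> 'x"
  assumes "filterlim (\<lambda>n. dist (u n) w) at_top sequentially"
  shows "\<exists>r. strict_mono (r :: nat \<Rightarrow> nat) \<and> u \<circ> r \<in> gromov_sequences"
  using gromov_subsequence[OF proper path_metric assms] by blast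

subsection \<open>Bounded parabolic points\<close>

lemma loxodromic_if_translation:
  assumes g: "g \<in> Stab p" and p: "p \<in> gromov_boundary" and shift: "20 * \<delta> \<le> busemann p (\<phi> g w) w"
  shows "loxodromic G bdry_top (boundary_action \<phi>) g"
proof -
  have gG: "g \<in> carrier G" and gp: "push (\<phi> g) p = p" using g by (auto simp: Stab_def)
  note tr = translation_two_fixed_points[OF isometry_action[OF gG] push_in_boundary[OF gG] p gp shift
      ex_gromov_subsequence[of _ w]]
  have lim: "filterlim (\<lambda>n. dist ((\<phi> g ^^ n) w) w) at_top sequentially"
    by (rule tr(1))
  have "g [^] n \<noteq> \<one>" if "0 < n" for n :: nat
  proof
    assume "g [^] n = \<one>"
    then have "g [^] (n * m) = \<one>" for m
      using gG by (metis nat_pow_one nat_pow_pow)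
    then have zero: "dist ((\<phi> g ^^ (n * m)) w) w = 0" for m
      using action_pow[OF gG, of "n * m"] action_one by simp
    have "\<forall>\<^sub>F i in sequentially. 1 \<le> dist ((\<phi> g ^^ i) w) w"
      using lim unfolding filterlim_at_top by blast
    then obtain N where N: "\<forall>i\<ge>N. 1 \<le> dist ((\<phi> g ^^ i) w) w"
      unfolding eventually_sequentially by blast
    have "N \<le> n * N" using that by simp
    then have "1 \<le> dist ((\<phi> g ^^ (n * N)) w) w" using N by blast
    then show False using zero[of N] by linarith
  qed
  moreover have "\<exists>q. q \<noteq> p \<and> {\<xi> \<in> gromov_boundary. push (\<phi> g) \<xi> = \<xi>} = {p, q}"
    by (rule tr(2))
  moreover have "invariants (topspace bdry_top) (boundary_action \<phi>) g
      = {\<xi> \<in> gromov_boundary. push (\<phi> g) \<xi> = \<xi>}"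
    unfolding invariants_def topspace_boundary_topology
    by (intro Collect_cong conj_cong refl) (simp add: boundary_action_push)
  ultimately show ?thesis
    using gG unfolding loxodromic_def by (metis card_2_iff)
qed

text \<open>An element shifting the Busemann function up is loxodromic, and one shifting it down has
  an inverse that shifts it up.\<close>

lemma busemann_no_loxodromic:
  assumes p: "p \<in> gromov_boundary"
    and par: "\<forall>g\<in>Stab p. \<not> loxodromic G bdry_top (boundary_action \<phi>) g" and g: "g \<in> Stab p"
  shows "\<bar>busemann p (\<phi> g w) w\<bar> \<le> 40 * \<delta>"
proof -
  have up: "busemann p (\<phi> h w) w < 20 * \<delta>" if "h \<in> Stab p" for h
    using loxodromic_if_translation[OF that p, of w] par that by fastforce
  have "g \<in> carrier G" "push (\<phi> (inv g)) p = p" "inv g \<in> carrier G"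
    using g Stab_inv[OF g] by (auto simp: Stab_def)
  then have "\<bar>busemann p (\<phi> (inv g) w) w - busemann p w (\<phi> g w)\<bar> \<le> 4 * \<delta>"
    using busemann_action[of "inv g" p w "\<phi> g w"] p by simp
  then show ?thesis
    using up[OF g] up[OF Stab_inv[OF g]] busemann_swap[OF p, of w "\<phi> g w"] delta_ge_1 by linarith
qed

context
  fixes p :: "(nat \<Rightarrow> 'x) set"
  assumes bp: "bounded_parabolic_point G bdry_top (boundary_action \<phi>) p"
begin

lemma parabolic_in_boundary: "p \<in> gromov_boundary"
  using bp unfolding bounded_parabolic_point_def by simp

lemma infinite_Stab: "infinite (Stab p)"
  using bp unfolding bounded_parabolic_point_def by (simp add: stabilizer_eq_Stab[OF parabolic_in_boundary])

lemma parabolic_busemann: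
  assumes "k \<in> Stab p"
  shows "\<bar>busemann p (\<phi> k w) w\<bar> \<le> 40 * \<delta>" "\<bar>busemann p (\<phi> k x) w - busemann p x w\<bar> \<le> 50 * \<delta>"
proof -
  have k: "k \<in> carrier G" "push (\<phi> k) p = p" using assms by (auto simp: Stab_def)
  show 1: "\<bar>busemann p (\<phi> k w) w\<bar> \<le> 40 * \<delta>"
    using bp parabolic_in_boundary assms unfolding bounded_parabolic_point_def
    by (intro busemann_no_loxodromic) (auto simp: stabilizer_eq_Stab)
  have "\<bar>busemann p (\<phi> k x) (\<phi> k w) - busemann p x w\<bar> \<le> 4 * \<delta>"
    using busemann_action[OF k(1) parabolic_in_boundary, of x w] k by simp
  then show "\<bar>busemann p (\<phi> k x) w - busemann p x w\<bar> \<le> 50 * \<delta>"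
    using 1 busemann_triangle[OF parabolic_in_boundary, of "\<phi> k x" w "\<phi> k w"] by linarith
qed

text \<open>Cocompactness read in the space: the stabiliser can move every line ending at
  \<open>p\<close> so that it passes near \<open>w\<close>.\<close>

lemma parabolic_cocompact:
  obtains C where "0 \<le> C"
    "\<And>\<eta>. \<eta> \<in> gromov_boundary \<Longrightarrow> \<eta> \<noteq> p \<Longrightarrow> \<exists>k\<in>Stab p. gromov_le w p (push (\<phi> k) \<eta>) C"
proof -
  obtain K where K: "compactin bdry_top K" "K \<subseteq> gromov_boundary - {p}"
      "(\<Union>g\<in>Stab p. boundary_action \<phi> g ` K) = gromov_boundary - {p}"
    using bp parabolic_in_boundary unfolding bounded_parabolic_point_def acts_cocompactly_on_def
    by (auto simp: stabilizer_eq_Stab)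
  obtain C where C: "0 \<le> C" "\<And>\<eta>. \<eta> \<in> K \<Longrightarrow> gromov_le w p \<eta> C"
    using compactin_gromov_le[OF K(1,2) parabolic_in_boundary] by blast
  have "\<exists>k\<in>Stab p. gromov_le w p (push (\<phi> k) \<eta>) C" if \<eta>: "\<eta> \<in> gromov_boundary" "\<eta> \<noteq> p" for \<eta>
  proof -
    have "\<eta> \<in> (\<Union>g\<in>Stab p. boundary_action \<phi> g ` K)"
      unfolding K(3) using \<eta> by blast
    then obtain g \<kappa> where g: "g \<in> Stab p" "\<kappa> \<in> K" "\<eta> = boundary_action \<phi> g \<kappa>"
      by blast
    then have "push (\<phi> (inv g)) \<eta> = \<kappa>"
      using K(2) boundary_action_push[of \<kappa> g] by (auto simp: Stab_def)
    then show ?thesis using C(2)[OF g(2)] Stab_inv[OF g(1)] by auto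
  qed
  then show thesis using that C(1) by blast
qed

text \<open>Every point of the hull lies on a line from \<open>p\<close>, which some \<open>k\<close> moves close to \<open>w\<close>.\<close>

lemma parabolic_translate:
  obtains D where "0 \<le> D" "\<And>x. x \<in> boundary_hull C \<Longrightarrow> \<exists>k\<in>Stab p.
    dist (\<phi> k x) w \<le> \<bar>busemann p x w\<bar> + D"
proof -
  obtain C' where C': "0 \<le> C'"
      "\<And>\<eta>. \<eta> \<in> gromov_boundary \<Longrightarrow> \<eta> \<noteq> p \<Longrightarrow> \<exists>k\<in>Stab p. gromov_le w p (push (\<phi> k) \<eta>) C'"
    using parabolic_cocompact by blast
  define M where "M = max C' (C + \<delta>)"
  have "\<exists>k\<in>Stab p. dist (\<phi> k x) w \<le> \<bar>busemann p x w\<bar> + (2 * M + 58 * \<delta>)"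
    if x: "x \<in> boundary_hull C" for x
  proof -
    obtain \<xi> \<eta> where \<xi>: "\<xi> \<in> gromov_boundary" "\<eta> \<in> gromov_boundary" "gromov_le x \<xi> \<eta> C"
      using x unfolding boundary_hull_def by blast
    have "p \<noteq> {}" using boundary_nonempty[OF parabolic_in_boundary] by blast
    then obtain \<zeta> where \<zeta>: "\<zeta> \<in> gromov_boundary" "gromov_le x p \<zeta> (C + \<delta>)"
      using gromov_le_split[OF \<xi>(3), of p] \<xi> gromov_le_commute by blast
    then have "\<zeta> \<noteq> p" using not_gromov_le_self[OF parabolic_in_boundary] by blast
    then obtain k where k: "k \<in> Stab p" "gromov_le w p (push (\<phi> k) \<zeta>) C'"
      using C' \<zeta> by blast
    then have kG: "k \<in> carrier G" and kp: "push (\<phi> k) p = p" by (auto simp: Stab_def)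
    have "gromov_le (\<phi> k x) p (push (\<phi> k) \<zeta>) M"
      using gromov_le_action[OF kG \<zeta>(2)] kp gromov_le_mono[of _ _ _ "C + \<delta>" M] by (simp add: M_def)
    moreover have "gromov_le w p (push (\<phi> k) \<zeta>) M"
      using k(2) gromov_le_mono[of _ _ _ C' M] by (simp add: M_def)
    ultimately have "dist (\<phi> k x) w \<le> \<bar>busemann p (\<phi> k x) w\<bar> + 2 * M + 8 * \<delta>"
      using dist_le_busemann[OF parabolic_in_boundary push_in_boundary[OF kG \<zeta>(1)]] by blast
    then show ?thesis
      using k(1) parabolic_busemann(2)[OF k(1), of x w] by (intro bexI[of _ k]) linarith+
  qed
  moreover have "0 \<le> 2 * M + 58 * \<delta>" using C'(1) delta_ge_1 by (simp add: M_def max_def)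
  ultimately show thesis using that by blast
qed

text \<open>If an orbit point lies deep in the horoball at \<open>p\<close>, then many elements of the infinite
  stabiliser displace it little, against proper discontinuity.\<close>

lemma orbit_avoids_horoball:
  assumes w: "w \<in> boundary_hull C"
  obtains B where "\<And>g. g \<in> carrier G \<Longrightarrow> - B \<le> busemann p (\<phi> g w) w"
proof (rule ccontr)
  assume "\<not> thesis"
  then have deep: "\<exists>g\<in>carrier G. busemann p (\<phi> g w) w < - B" for B
    using that by (metis not_le)
  obtain D where D: "0 \<le> D" "\<And>x. x \<in> boundary_hull C \<Longrightarrow>
      \<exists>k\<in>Stab p. dist (\<phi> k x) w \<le> \<bar>busemann p x w\<bar> + D"
    using parabolic_translate by blast
  define F where "F = {g \<in> carrier G. dist (\<phi> g w) w \<le> D + 110 * \<delta>}"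
  have "finite F" unfolding F_def by (rule finite_ball)
  \<comment> \<open>The size of \<open>F\<close> does not depend on the depth, so \<open>A\<close>
    can be fixed first and \<open>g0\<close> then taken deep enough for all elements of
    \<open>A\<close> at once.\<close>
  obtain A where A: "A \<subseteq> Stab p" "finite A" "card A = Suc (card F)"
    using infinite_arbitrarily_large[OF infinite_Stab] by metis
  define M where "M = (\<Sum>k\<in>A. dist w (\<phi> k w))"
  have M: "dist w (\<phi> k w) \<le> M" if "k \<in> A" for k
    unfolding M_def using A(2) that by (intro member_le_sum) auto
  obtain g0 where g0: "g0 \<in> carrier G" "busemann p (\<phi> g0 w) w < - (\<bar>M\<bar> + 100 * \<delta>)"
    using deep by blast
  obtain h where h: "h \<in> Stab p" "dist (\<phi> h (\<phi> g0 w)) w \<le> \<bar>busemann p (\<phi> g0 w) w\<bar> + D"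
    using D(2)[OF boundary_hull_action[OF g0(1) w]] by blast
  define g where "g = h \<otimes> g0"
  have hG: "h \<in> carrier G" using h by (simp add: Stab_def)
  have gG: "g \<in> carrier G" using hG g0 by (simp add: g_def)
  have gw: "\<phi> g w = \<phi> h (\<phi> g0 w)" using hG g0 by (simp add: g_def action_mult)
  have deep_g: "\<bar>M\<bar> + 50 * \<delta> \<le> - busemann p (\<phi> g w) w"
    and ray_g: "dist (\<phi> g w) w \<le> D + 50 * \<delta> - busemann p (\<phi> g w) w"
    using parabolic_busemann(2)[OF h(1), of "\<phi> g0 w" w] h(2) g0(2) delta_ge_1 unfolding gw by linarith+
  \<comment> \<open>The conjugate moves \<open>w\<close> as far as \<open>k\<close> moves
    \<open>\<phi> g w\<close>. The \<open>110\<close> in \<open>F\<close> is \<open>50\<close> from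
    \<open>ray_g\<close> plus \<open>60\<close> from \<open>parabolic_displacement\<close>.\<close>
  have "inv g \<otimes> k \<otimes> g \<in> F" if k: "k \<in> A" for k
  proof -
    have kS: "k \<in> Stab p" using k A by blast
    then have kG: "k \<in> carrier G" and kp: "push (\<phi> k) p = p" by (auto simp: Stab_def)
    have "dist (\<phi> k (\<phi> g w)) (\<phi> g w) \<le> (D + 50 * \<delta>) + 60 * \<delta>"
      using parabolic_busemann(1)[OF kS, of w] ray_g deep_g M[OF k] D(1) delta_ge_1
      by (intro parabolic_displacement[OF isometry_action[OF kG] kp parabolic_in_boundary]) auto
    moreover have "\<phi> (inv g \<otimes> k \<otimes> g) w = \<phi> (inv g) (\<phi> k (\<phi> g w))"
      using gG kG by (simp add: action_mult)
    ultimately show ?thesis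
      using gG kG by (simp add: F_def dist_action_inv)
  qed
  moreover have "inj_on (\<lambda>k. inv g \<otimes> k \<otimes> g) A"
  proof (rule inj_onI)
    fix k k' assume "k \<in> A" "k' \<in> A" and eq: "inv g \<otimes> k \<otimes> g = inv g \<otimes> k' \<otimes> g"
    then have "k \<in> carrier G" "k' \<in> carrier G" using A(1) by (auto simp: Stab_def)
    then show "k = k'" using eq gG by simp
  qed
  ultimately have "card A \<le> card F"
    using card_inj_on_le[of "\<lambda>k. inv g \<otimes> k \<otimes> g" A F] \<open>finite F\<close> by blast
  then show False using A(3) by simp
qed

text \<open>A point deep in the horoball at \<open>p\<close> which \<open>h\<close> moves little is also deep in the disjoint
  horoball at \<open>h p\<close>, unless \<open>h\<close> fixes \<open>p\<close>.\<close>

lemma deep_in_horoball_fixes: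
  assumes w: "w \<in> boundary_hull C"
  obtains R where "\<And>x h. h \<in> carrier G \<Longrightarrow> dist (\<phi> h x) x \<le> L \<Longrightarrow> busemann p x w < - R \<Longrightarrow> h \<in> Stab p"
proof -
  obtain B where B: "\<And>g. g \<in> carrier G \<Longrightarrow> - B \<le> busemann p (\<phi> g w) w"
    using orbit_avoids_horoball[OF w] by blast
  obtain C' where C': "0 \<le> C'"
      "\<And>\<eta>. \<eta> \<in> gromov_boundary \<Longrightarrow> \<eta> \<noteq> p \<Longrightarrow> \<exists>k\<in>Stab p. gromov_le w p (push (\<phi> k) \<eta>) C'"
    using parabolic_cocompact by blast
  have "h \<in> Stab p" if h: "h \<in> carrier G" "dist (\<phi> h x) x \<le> L"
      and deep: "busemann p x w < - (\<bar>L\<bar> + \<bar>B\<bar> + 2 * C' + 120 * \<delta>)" for x h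
  proof (rule ccontr)
    assume "h \<notin> Stab p"
    define q where "q = push (\<phi> h) p"
    have q: "q \<in> gromov_boundary" "q \<noteq> p"
      using \<open>h \<notin> Stab p\<close> h push_in_boundary[OF h(1) parabolic_in_boundary] by (auto simp: Stab_def q_def)
    obtain k where k: "k \<in> Stab p" "gromov_le w p (push (\<phi> k) q) C'" using C' q by blast
    then have kG: "k \<in> carrier G" "inv k \<in> carrier G" and kp: "push (\<phi> (inv k)) p = p"
      using Stab_inv[OF k(1)] by (auto simp: Stab_def)
    \<comment> \<open>This point is near the line from \<open>p\<close> to \<open>q\<close>, has
      bounded height at \<open>p\<close> because \<open>inv k\<close> fixes \<open>p\<close>, and as
      an orbit point is not deep at \<open>q\<close>. So relative to \<open>y\<close> both Busemann
      functions at \<open>x\<close> are about as negative as \<open>busemann p x w\<close>, against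
      \<open>busemann_line_lower\<close>.\<close>
    define y where "y = \<phi> (inv k) w"
    have "gromov_le y p q C'"
      using gromov_le_action[OF kG(2) k(2)] kp kG(1) by (simp add: y_def)
    then have "- 2 * C' - 8 * \<delta> \<le> busemann p x y + busemann q x y"
      by (rule busemann_line_lower[OF parabolic_in_boundary q(1)])
    moreover have "busemann p x y \<le> busemann p x w + 54 * \<delta>"
      using busemann_triangle[OF parabolic_in_boundary, of x y w] busemann_swap[OF parabolic_in_boundary, of w y]
        parabolic_busemann(1)[OF Stab_inv[OF k(1)], of w] unfolding y_def by linarith
    moreover have "busemann q x y \<le> busemann p x w + \<bar>L\<bar> + \<bar>B\<bar> + 30 * \<delta>"
    proof -
      let ?x = "\<phi> (inv h) x" and ?y = "\<phi> (inv h) y"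
      have "busemann q x y \<le> busemann p ?x ?y + 4 * \<delta>"
        using busemann_action[OF h(1) parabolic_in_boundary, of ?x ?y] h(1) by (simp add: q_def)
      moreover have "?y = \<phi> (inv h \<otimes> inv k) w"
        using h(1) kG by (simp add: y_def action_mult)
      then have "- B \<le> busemann p ?y w"
        using B[of "inv h \<otimes> inv k"] h(1) kG by simp
      moreover have "dist ?x x \<le> L"
        using h(2) dist_action_inv[OF h(1), of x x] by (simp add: dist_commute)
      then have "busemann p ?x x \<le> L + 2 * \<delta>"
        using busemann_le_dist[OF parabolic_in_boundary, of ?x x] by linarith
      ultimately show ?thesis
        using busemann_triangle[OF parabolic_in_boundary, of ?x ?y w] busemann_swap[OF parabolic_in_boundary, of ?y w]
          busemann_triangle[OF parabolic_in_boundary, of ?x w x] delta_ge_1 by linarith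
    qed
    ultimately show False using deep C'(1) delta_ge_1 by linarith
  qed
  then show thesis using that by blast
qed

text \<open>Convergence to \<open>p\<close> makes \<open>dist (u i) w - busemann p (u i) w\<close>
  large, which alone would allow an approach outside every horoball. As \<open>w\<close> is almost
  nearest in its orbit, \<open>parabolic_translate\<close> bounds the distance by the absolute value
  of the Busemann function plus a constant; hence that function is very negative.\<close>

lemma parabolic_limit_fixes:
  assumes w: "w \<in> boundary_hull C" and u: "u \<in> p" "\<And>i. u i \<in> boundary_hull C"
    and nearest: "\<And>i g. g \<in> carrier G \<Longrightarrow> dist (u i) w \<le> dist (u i) (\<phi> g w) + 1"
  obtains i where "\<And>h. h \<in> carrier G \<Longrightarrow> dist (\<phi> h (u i)) (u i) \<le> L \<Longrightarrow> h \<in> Stab p"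
proof -
  obtain R where R: "\<And>x h. h \<in> carrier G \<Longrightarrow> dist (\<phi> h x) x \<le> L \<Longrightarrow> busemann p x w < - R \<Longrightarrow> h \<in> Stab p"
    using deep_in_horoball_fixes[OF w] by blast
  obtain D where D: "0 \<le> D" "\<And>x. x \<in> boundary_hull C \<Longrightarrow>
      \<exists>k\<in>Stab p. dist (\<phi> k x) w \<le> \<bar>busemann p x w\<bar> + D"
    using parabolic_translate by blast
  obtain N where N: "\<forall>i\<ge>N. \<forall>j\<ge>N. \<bar>R\<bar> + D + 2 * \<delta> \<le> gromov_product w (u i) (u j)"
    using boundary_rel_in_boundary[OF parabolic_in_boundary u(1) u(1)] boundary_rel_iff[of u u w] by blast
  obtain j where j: "\<bar>dist (u N) (u j) - dist w (u j) - busemann p (u N) w\<bar> \<le> 2 * \<delta>" "N \<le> j"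
    using eventually_happens'[OF sequentially_bot eventually_conj[OF
        busemann_eventually[OF parabolic_in_boundary u(1), of "u N" w] eventually_ge_at_top]] by blast
  have "\<bar>R\<bar> + D + 2 * \<delta> \<le> gromov_product w (u N) (u j)" using N j by blast
  then have 1: "2 * \<bar>R\<bar> + 2 * D + 2 * \<delta> \<le> dist (u N) w - busemann p (u N) w"
    using j unfolding gromov_product_def by (simp add: dist_commute field_simps)
  obtain k where k: "k \<in> Stab p" "dist (\<phi> k (u N)) w \<le> \<bar>busemann p (u N) w\<bar> + D"
    using D(2)[OF u(2)] by blast
  then have kG: "k \<in> carrier G" by (simp add: Stab_def)
  have "dist (u N) w \<le> \<bar>busemann p (u N) w\<bar> + D + 1"
    using nearest[of "inv k" N] k(2) kG dist_action_inv[of "inv k" "u N" w] by simp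
  then have "busemann p (u N) w < - R" using 1 D(1) delta_ge_1 by linarith
  then show thesis using R that by blast
qed

end

subsection \<open>Conical limit points\<close>

text \<open>The images of \<open>p\<close> and \<open>x\<close> tend to distinct points
  \<open>a\<close> and \<open>b\<close>, so the line between them eventually passes near
  \<open>w\<close>; applying \<open>inv (g n)\<close> puts an orbit point near the line from
  \<open>p\<close> to \<open>x\<close>, with \<open>C\<close> independent of
  \<open>x\<close>.\<close>

lemma conical_orbit_near:
  assumes "p \<in> gromov_boundary" "conical_limit_point G bdry_top (boundary_action \<phi>) p"
  obtains C g b where "range g \<subseteq> carrier G" "b \<in> gromov_boundary"
    "\<And>x r. x \<in> gromov_boundary \<Longrightarrow> x \<noteq> p \<Longrightarrow> \<forall>\<^sub>F n :: nat in sequentially. push (\<phi> (g n)) x \<in> boundary_nbhd w r b"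
    "\<And>x. x \<in> gromov_boundary \<Longrightarrow> x \<noteq> p \<Longrightarrow> \<forall>\<^sub>F n in sequentially. gromov_le (\<phi> (inv (g n)) w) p x C"
proof -
  obtain g a b where g: "range g \<subseteq> carrier G" and ab: "a \<in> gromov_boundary" "b \<in> gromov_boundary" "a \<noteq> b"
    and lim_p: "limitin bdry_top (\<lambda>n. boundary_action \<phi> (g n) p) a sequentially"
    and lim: "\<And>x. x \<in> gromov_boundary - {p} \<Longrightarrow>
      limitin bdry_top (\<lambda>n. boundary_action \<phi> (g n) x) b sequentially"
    using assms unfolding conical_limit_point_def topspace_boundary_topology by blast
  obtain C where C: "gromov_le w a b C" using gromov_le_distinct[OF ab] by blast
  have nbhd: "\<forall>\<^sub>F n in sequentially. push (\<phi> (g n)) x \<in> boundary_nbhd w r b"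
    if "x \<in> gromov_boundary" "x \<noteq> p" for x r
    using limitin_boundary_nbhd[OF lim] boundary_action_push that by simp
  have "\<forall>\<^sub>F n in sequentially. gromov_le (\<phi> (inv (g n)) w) p x (C + 2 * \<delta>)"
    if x: "x \<in> gromov_boundary" "x \<noteq> p" for x
    using nbhd[OF x, of "C + 5 * \<delta>"] limitin_boundary_nbhd[OF lim_p, of w "C + 5 * \<delta>"]
  proof eventually_elim
    case (elim n)
    have gn: "g n \<in> carrier G" using g by blast
    have "gromov_le w a (push (\<phi> (g n)) x) (C + \<delta>)"
      using gromov_le_boundary_nbhd[OF ab(2) elim(1) C] delta_ge_1 by simp
    then have "gromov_le w (push (\<phi> (g n)) x) a (C + \<delta>)"
      by (rule gromov_le_commute)
    moreover have "push (\<phi> (g n)) p \<in> boundary_nbhd w (C + 5 * \<delta>) a"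
      using elim(2) assms(1) by (simp add: boundary_action_push)
    ultimately have "gromov_le w (push (\<phi> (g n)) x) (push (\<phi> (g n)) p) (C + \<delta> + \<delta>)"
      using gromov_le_boundary_nbhd[OF ab(1), of "push (\<phi> (g n)) p" w "C + 5 * \<delta>"
          "push (\<phi> (g n)) x" "C + \<delta>"] delta_ge_1 by linarith
    then have "gromov_le (\<phi> (inv (g n)) w) x p (C + \<delta> + \<delta>)"
      using gromov_le_action[of "inv (g n)" w] gn by fastforce
    then have "gromov_le (\<phi> (inv (g n)) w) p x (C + \<delta> + \<delta>)"
      by (rule gromov_le_commute)
    then show ?case by (rule gromov_le_mono) simp
  qed
  then show thesis using that[OF g ab(2) nbhd] by blast
qed

text \<open>Orbit points near the line from \<open>p\<close> to \<open>x\<close> might run off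
  towards \<open>x\<close>. The second line, to \<open>x'\<close>, prevents this by
  \<open>busemann_tripod\<close>.\<close>

lemma conical_deep_3:
  assumes p: "p \<in> gromov_boundary" "conical_limit_point G bdry_top (boundary_action \<phi>) p"
    and x: "x \<in> gromov_boundary" "x \<noteq> p" "x' \<in> gromov_boundary" "x' \<noteq> p" "x \<noteq> x'"
  shows "\<exists>g\<in>carrier G. busemann p (\<phi> g w) w \<le> - R"
proof -
  obtain C g b where g: "range g \<subseteq> carrier G" and b: "b \<in> gromov_boundary"
    and nbhd: "\<And>x r. x \<in> gromov_boundary \<Longrightarrow> x \<noteq> p \<Longrightarrow>
      \<forall>\<^sub>F n :: nat in sequentially. push (\<phi> (g n)) x \<in> boundary_nbhd w r b"
    and le: "\<And>x. x \<in> gromov_boundary \<Longrightarrow> x \<noteq> p \<Longrightarrow>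
      \<forall>\<^sub>F n in sequentially. gromov_le (\<phi> (inv (g n)) w) p x C"
    by (rule conical_orbit_near[OF p, of w]) (rule that)
  obtain C1 C2 C3 where C: "gromov_le w p x C1" "gromov_le w p x' C2" "gromov_le w x x' C3"
    using gromov_le_distinct p(1) x by metis
  define M where "M = max 0 (max C (max C1 (max C2 C3)))"
  \<comment> \<open>Otherwise the \<open>g n\<close> would eventually lie in a finite set, and a
    recurring element \<open>h\<close> would collapse all boundary points except \<open>p\<close> to
    \<open>b\<close>, though it acts injectively.\<close>
  have far: "\<exists>\<^sub>F n in sequentially. T < dist (\<phi> (inv (g n)) w) w" for T
  proof (rule ccontr)
    assume "\<not> (\<exists>\<^sub>F n in sequentially. T < dist (\<phi> (inv (g n)) w) w)"
    then have "\<forall>\<^sub>F n in sequentially. dist (\<phi> (inv (g n)) w) w \<le> T"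
      by (simp add: frequently_def not_less)
    moreover have "g n \<in> carrier G" "dist (\<phi> (inv (g n)) w) w = dist (\<phi> (g n) w) w" for n
      using g dist_action_inv[of "g n" w w] by (auto simp: dist_commute)
    ultimately have "\<forall>\<^sub>F n in sequentially. \<exists>h\<in>{h \<in> carrier G. dist (\<phi> h w) w \<le> T}. g n = h"
      by (elim eventually_mono) auto
    then have "\<exists>\<^sub>F n in sequentially. \<exists>h\<in>{h \<in> carrier G. dist (\<phi> h w) w \<le> T}. g n = h"
      by (rule eventually_frequently[OF sequentially_bot])
    then have "\<exists>h\<in>{h \<in> carrier G. dist (\<phi> h w) w \<le> T}. \<exists>\<^sub>F n in sequentially. g n = h"
      by (rule frequently_bex_finite[OF finite_ball])
    then obtain h where h: "h \<in> carrier G" "\<exists>\<^sub>F n in sequentially. g n = h"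
      by blast
    have "push (\<phi> h) z = b" if z: "z \<in> gromov_boundary" "z \<noteq> p" for z
    proof (rule ccontr)
      assume "push (\<phi> h) z \<noteq> b"
      then obtain C' where C': "gromov_le w b (push (\<phi> h) z) C'"
        using gromov_le_distinct[OF b push_in_boundary[OF h(1) z(1)]] by metis
      obtain n where "g n = h" "push (\<phi> (g n)) z \<in> boundary_nbhd w (C' + 3 * \<delta>) b"
        using frequently_ex[OF frequently_eventually_conj[OF h(2) nbhd[OF z, of "C' + 3 * \<delta>"]]] by blast
      then show False using boundary_nbhdD[OF b _, of _ w "C' + 3 * \<delta>" C'] C' delta_ge_1 by auto
    qed
    then have "push (\<phi> h) x = push (\<phi> h) x'" using x by simp
    then show False using x(5) push_inv(1)[OF h(1)] by metis
  qed
  define T where "T = \<bar>R\<bar> + 5 * M + 16 * \<delta>"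
  obtain n where n: "T < dist (\<phi> (inv (g n)) w) w"
      "gromov_le (\<phi> (inv (g n)) w) p x C" "gromov_le (\<phi> (inv (g n)) w) p x' C"
    using frequently_ex[OF frequently_eventually_conj[OF far eventually_conj[OF le[OF x(1,2)] le[OF x(3,4)]]]]
    by blast
  have M: "C \<le> M" "C1 \<le> M" "C2 \<le> M" "C3 \<le> M" "0 \<le> M" by (auto simp: M_def)
  have "busemann p (\<phi> (inv (g n)) w) w \<le> 2 * M + 8 * \<delta> - dist (\<phi> (inv (g n)) w) w"
    using C n M gromov_le_mono
    by (intro busemann_tripod[OF p(1) x(1) x(3)]) (auto simp: T_def intro: gromov_le_mono)
  then have "busemann p (\<phi> (inv (g n)) w) w \<le> - R"
    using n(1) M delta_ge_1 unfolding T_def by linarith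
  then show ?thesis using g by blast
qed

text \<open>With no third point to fix a direction, the stabiliser of \<open>p\<close> is used: it
  has index at most two, so it is infinite and contains some \<open>h\<close> moving
  \<open>w\<close> far along the line from \<open>p\<close> to \<open>q\<close>; \<open>h\<close> or
  its inverse does so towards \<open>p\<close>.\<close>

lemma two_point_boundary_deep:
  assumes pq: "gromov_boundary = {p, q}" "p \<noteq> q" and inf: "infinite (carrier G)"
  shows "\<exists>g\<in>carrier G. busemann p (\<phi> g w) w \<le> - R"
proof -
  have p: "p \<in> gromov_boundary" and q: "q \<in> gromov_boundary" using pq by auto
  have "infinite (Stab p)"
  proof
    assume fin: "finite (Stab p)"
    have cosets: "carrier G = Stab p \<union> {g \<in> carrier G. push (\<phi> g) p = q}"
    proof -
      have "push (\<phi> g) p = p \<or> push (\<phi> g) p = q" if "g \<in> carrier G" for g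
        using push_in_boundary[OF that p] unfolding pq(1) by blast
      then show ?thesis by (auto simp: Stab_def)
    qed
    have "finite {g \<in> carrier G. push (\<phi> g) p = q}"
    proof (cases "{g \<in> carrier G. push (\<phi> g) p = q} = {}")
      case False
      then obtain g0 where g0: "g0 \<in> carrier G" "push (\<phi> g0) p = q" by blast
      have "(\<lambda>g. inv g0 \<otimes> g) ` {g \<in> carrier G. push (\<phi> g) p = q} \<subseteq> Stab p"
        using g0 by (auto simp: Stab_def push_mult)
      moreover have "inj_on (\<lambda>g. inv g0 \<otimes> g) {g \<in> carrier G. push (\<phi> g) p = q}"
        using g0(1) by (intro inj_onI) simp
      ultimately show ?thesis
        using fin inj_on_finite by blast
    next
      case True
      then show ?thesis by (simp only: finite.emptyI)
    qed
    then have "finite (carrier G)"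
      by (subst cosets) (rule finite_UnI[OF fin])
    then show False using inf by blast
  qed
  moreover obtain C where C: "0 \<le> C" "gromov_le w p q C" using gromov_le_distinct[OF p q pq(2)] by blast
  ultimately obtain h where h: "h \<in> Stab p" "\<bar>R\<bar> + 2 * C + 20 * \<delta> < dist (\<phi> h w) w"
    using infinite_unbounded[of "Stab p"] unfolding Stab_def by blast
  then have hG: "h \<in> carrier G" and hp: "push (\<phi> h) p = p" "push (\<phi> (inv h)) p = p"
    using Stab_inv[OF h(1)] by (auto simp: Stab_def)
  have "push (\<phi> h) q = q"
    using push_in_boundary[OF hG q] pq hp push_inv(1)[OF hG] by (metis insertE singletonD)
  then have "gromov_le (\<phi> h w) p q C" using gromov_le_action[OF hG C(2)] hp by simp
  then have "dist (\<phi> h w) w \<le> \<bar>busemann p (\<phi> h w) w\<bar> + 2 * C + 8 * \<delta>"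
    using C(2) by (rule dist_le_busemann[OF p q])
  moreover have "\<bar>busemann p (\<phi> (inv h) w) w - busemann p w (\<phi> h w)\<bar> \<le> 4 * \<delta>"
    using busemann_action[of "inv h" p w "\<phi> h w"] p hG hp by simp
  ultimately have "busemann p (\<phi> h w) w \<le> - R \<or> busemann p (\<phi> (inv h) w) w \<le> - R"
    using h(2) busemann_swap[OF p, of w "\<phi> h w"] C(1) delta_ge_1 by linarith
  then show ?thesis using hG by blast
qed

lemma conical_deep:
  assumes p: "p \<in> gromov_boundary" "conical_limit_point G bdry_top (boundary_action \<phi>) p"
    and inf: "infinite (carrier G)"
  shows "\<exists>g\<in>carrier G. busemann p (\<phi> g w) w \<le> - R"
proof -
  obtain q where q: "q \<in> gromov_boundary" "q \<noteq> p"
    using p(2) unfolding conical_limit_point_def topspace_boundary_topology by metis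
  show ?thesis
  proof (cases "gromov_boundary = {p, q}")
    case True
    then show ?thesis using two_point_boundary_deep q inf by blast
  next
    case False
    then obtain x where "x \<in> gromov_boundary" "x \<noteq> p" "x \<noteq> q" using p q by blast
    then show ?thesis using conical_deep_3[OF p q, of x w R] by metis
  qed
qed

lemma conical_not_limit:
  assumes p: "p \<in> gromov_boundary" "conical_limit_point G bdry_top (boundary_action \<phi>) p"
    and inf: "infinite (carrier G)" and u: "u \<in> p"
  shows "\<exists>i. \<exists>g\<in>carrier G. dist (u i) (\<phi> g w) + 1 < dist (u i) w"
proof -
  \<comment> \<open>\<open>2 * \<delta>\<close> pays for the Busemann error, and \<open>2\<close>
    leaves a gain beyond the tolerance \<open>1\<close>.\<close>
  obtain g where g: "g \<in> carrier G" "busemann p (\<phi> g w) w \<le> - (2 * \<delta> + 2)"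
    using conical_deep[OF p inf] by blast
  obtain i where "\<bar>dist (\<phi> g w) (u i) - dist w (u i) - busemann p (\<phi> g w) w\<bar> \<le> 2 * \<delta>"
    using eventually_happens'[OF sequentially_bot busemann_eventually[OF p(1) u]] by blast
  then have "dist (u i) (\<phi> g w) + 1 < dist (u i) w" using g(2) by (simp add: dist_commute)
  then show ?thesis using g(1) by blast
qed

end

section \<open>Conjugating automorphisms\<close>

context group
begin

lemma conj_mult:
  assumes "g \<in> carrier G" "x \<in> carrier G" "y \<in> carrier G"
  shows "g \<otimes> (x \<otimes> y) \<otimes> inv g = (g \<otimes> x \<otimes> inv g) \<otimes> (g \<otimes> y \<otimes> inv g)"
proof -
  have "(g \<otimes> x \<otimes> inv g) \<otimes> (g \<otimes> y \<otimes> inv g) = g \<otimes> x \<otimes> (inv g \<otimes> g) \<otimes> y \<otimes> inv g"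
    using assms by (simp only: m_assoc m_closed inv_closed)
  then show ?thesis using assms by (simp add: m_assoc)
qed

lemma conj_conj:
  assumes "g \<in> carrier G" "h \<in> carrier G" "x \<in> carrier G"
  shows "g \<otimes> (h \<otimes> x \<otimes> inv h) \<otimes> inv g = (g \<otimes> h) \<otimes> x \<otimes> inv (g \<otimes> h)"
  using assms by (simp add: inv_mult_group m_assoc)

lemma conj_inv_conj:
  assumes "g \<in> carrier G" "x \<in> carrier G"
  shows "inv g \<otimes> (g \<otimes> x \<otimes> inv g) \<otimes> g = x" "g \<otimes> (inv g \<otimes> x \<otimes> g) \<otimes> inv g = x"
  using conj_conj[of "inv g" g x] conj_conj[of g "inv g" x] assms by simp_all

lemma inner_in_auto:
  assumes g: "g \<in> carrier G" shows "(\<lambda>x\<in>carrier G. g \<otimes> x \<otimes> inv g) \<in> auto G"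
proof -
  have "bij_betw (\<lambda>x\<in>carrier G. g \<otimes> x \<otimes> inv g) (carrier G) (carrier G)"
    using g by (intro bij_betw_byWitness[where f' = "\<lambda>x. inv g \<otimes> x \<otimes> g"]) (auto simp: conj_inv_conj)
  then show ?thesis
    using g unfolding auto_def hom_def Bij_def by (auto simp: conj_mult)
qed

lemma ConjD:
  assumes "f \<in> Conj G"
  shows "f \<in> hom G G" "f \<in> Bij (carrier G)" "f \<in> auto G" "f ` carrier G = carrier G"
    "\<And>x. x \<in> carrier G \<Longrightarrow> \<exists>h\<in>carrier G. f x = h \<otimes> x \<otimes> inv h"
  using assms unfolding Conj_def auto_def Bij_def bij_betw_def by auto

lemma subgroup_Conj: "subgroup (Conj G) (BijGroup (carrier G))"
proof (rule subgroup.intro)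
  note auto_sub = subgroup_auto
  show "Conj G \<subseteq> carrier (BijGroup (carrier G))"
    using subgroup.subset[OF auto_sub] unfolding Conj_def by blast
  show "\<one>\<^bsub>BijGroup (carrier G)\<^esub> \<in> Conj G"
    using subgroup.one_closed[OF auto_sub] unfolding Conj_def by (auto simp: BijGroup_def intro!: bexI[of _ \<one>])
  show "f \<otimes>\<^bsub>BijGroup (carrier G)\<^esub> f' \<in> Conj G" if f: "f \<in> Conj G" and f': "f' \<in> Conj G" for f f'
  proof -
    have "f \<otimes>\<^bsub>BijGroup (carrier G)\<^esub> f' = compose (carrier G) f f'"
      using ConjD(2)[OF f] ConjD(2)[OF f'] by (simp add: BijGroup_def)
    moreover have "\<exists>h\<in>carrier G. f (f' x) = h \<otimes> x \<otimes> inv h" if x: "x \<in> carrier G" for x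
    proof -
      obtain h' where h': "h' \<in> carrier G" "f' x = h' \<otimes> x \<otimes> inv h'" using ConjD(5)[OF f' x] by blast
      obtain h where h: "h \<in> carrier G" "f (f' x) = h \<otimes> f' x \<otimes> inv h"
        using ConjD(5)[OF f, of "f' x"] h' x by auto
      then show ?thesis using h h' x conj_conj by (intro bexI[of _ "h \<otimes> h'"]) auto
    qed
    ultimately show ?thesis
      using subgroup.m_closed[OF auto_sub ConjD(3)[OF f] ConjD(3)[OF f']] unfolding Conj_def
      by (simp add: compose_eq)
  qed
  show "inv\<^bsub>BijGroup (carrier G)\<^esub> f \<in> Conj G" if f: "f \<in> Conj G" for f
  proof -
    have "\<exists>h\<in>carrier G. inv_into (carrier G) f x = h \<otimes> x \<otimes> inv h" if x: "x \<in> carrier G" for x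
    proof -
      let ?y = "inv_into (carrier G) f x"
      have y: "?y \<in> carrier G" "f ?y = x"
        using ConjD(4)[OF f] x by (auto intro: inv_into_into f_inv_into_f)
      obtain h where h: "h \<in> carrier G" "f ?y = h \<otimes> ?y \<otimes> inv h" using ConjD(5)[OF f y(1)] by blast
      have "inv h \<otimes> x \<otimes> h = ?y" using conj_inv_conj(1)[OF h(1) y(1)] h y by simp
      then show ?thesis using h(1) by (intro bexI[of _ "inv h"]) auto
    qed
    then show ?thesis
      using subgroup.m_inv_closed[OF auto_sub ConjD(3)[OF f]] inv_BijGroup[OF ConjD(2)[OF f]]
      unfolding Conj_def by simp
  qed
qed

lemma ConjGroup_eq: "ConjGroup G = BijGroup (carrier G) \<lparr>carrier := Conj G\<rparr>"
  by (simp add: AutoGroup_def)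

lemma group_ConjGroup: "group (ConjGroup G)"
  unfolding ConjGroup_eq by (rule subgroup.subgroup_is_group[OF subgroup_Conj group_BijGroup])

lemma ConjGroup_mult:
  assumes "f \<in> Conj G" "f' \<in> Conj G"
  shows "f \<otimes>\<^bsub>ConjGroup G\<^esub> f' = compose (carrier G) f f'"
  using ConjD(2)[OF assms(1)] ConjD(2)[OF assms(2)] by (simp add: ConjGroup_eq BijGroup_def)

lemma Inn_subset_Conj: "Inn G \<subseteq> Conj G"
  using inner_in_auto unfolding Inn_def Conj_def by auto

lemma subgroup_Inn: "subgroup (Inn G) (ConjGroup G)"
proof (rule group.subgroupI[OF group_ConjGroup])
  let ?i = "\<lambda>g. \<lambda>x\<in>carrier G. g \<otimes> x \<otimes> inv g"
  have mult: "?i g \<otimes>\<^bsub>ConjGroup G\<^esub> ?i h = ?i (g \<otimes> h)" if "g \<in> carrier G" "h \<in> carrier G" for g h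
  proof -
    have "?i g \<in> Conj G" "?i h \<in> Conj G" using Inn_subset_Conj that unfolding Inn_def by auto
    then have "?i g \<otimes>\<^bsub>ConjGroup G\<^esub> ?i h = compose (carrier G) (?i g) (?i h)"
      by (rule ConjGroup_mult)
    also have "\<dots> = ?i (g \<otimes> h)"
      using that by (intro extensionalityI[where A = "carrier G"]) (simp_all add: compose_eq conj_conj)
    finally show ?thesis .
  qed
  have one: "?i \<one> = \<one>\<^bsub>ConjGroup G\<^esub>"
    by (intro extensionalityI[where A = "carrier G"]) (simp_all add: ConjGroup_eq BijGroup_def)
  show "Inn G \<subseteq> carrier (ConjGroup G)" using Inn_subset_Conj by simp
  show "Inn G \<noteq> {}" unfolding Inn_def by auto
  show "f \<otimes>\<^bsub>ConjGroup G\<^esub> f' \<in> Inn G" if "f \<in> Inn G" "f' \<in> Inn G" for f f'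
  proof -
    obtain g h where gh: "g \<in> carrier G" "f = ?i g" "h \<in> carrier G" "f' = ?i h"
      using \<open>f \<in> Inn G\<close> \<open>f' \<in> Inn G\<close> unfolding Inn_def by blast
    then have "f \<otimes>\<^bsub>ConjGroup G\<^esub> f' = ?i (g \<otimes> h)" using mult by blast
    moreover have "g \<otimes> h \<in> carrier G" using gh by simp
    ultimately show ?thesis unfolding Inn_def by blast
  qed
  show "inv\<^bsub>ConjGroup G\<^esub> f \<in> Inn G" if f: "f \<in> Inn G" for f
  proof -
    obtain g where g: "g \<in> carrier G" "f = ?i g" using f unfolding Inn_def by blast
    have "?i (inv g) \<in> Inn G" using g(1) unfolding Inn_def by blast
    moreover have "inv\<^bsub>ConjGroup G\<^esub> f = ?i (inv g)"
    proof (rule group.inv_equality[OF group_ConjGroup])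
      show "?i (inv g) \<otimes>\<^bsub>ConjGroup G\<^esub> f = \<one>\<^bsub>ConjGroup G\<^esub>"
        using mult[of "inv g" g] g one by simp
      show "f \<in> carrier (ConjGroup G)" "?i (inv g) \<in> carrier (ConjGroup G)"
        using f \<open>?i (inv g) \<in> Inn G\<close> Inn_subset_Conj by auto
    qed
    ultimately show ?thesis by simp
  qed
qed

text \<open>Composing \<open>f\<close> with an inner automorphism stays in its right coset, so
  \<open>T\<close> meets every coset.\<close>

lemma finite_index_InnI:
  assumes T: "finite T" "\<And>f. f \<in> Conj G \<Longrightarrow> \<exists>g\<in>carrier G. (\<lambda>x\<in>carrier G. g \<otimes> f x \<otimes> inv g) \<in> T"
  shows "finite_index (Inn G) (ConjGroup G)"
proof -
  interpret C: group "ConjGroup G" by (rule group_ConjGroup)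
  have "rcosets\<^bsub>ConjGroup G\<^esub> (Inn G) \<subseteq> (\<lambda>f. Inn G #>\<^bsub>ConjGroup G\<^esub> f) ` T"
  proof
    fix A assume "A \<in> rcosets\<^bsub>ConjGroup G\<^esub> (Inn G)"
    then obtain f where f: "f \<in> Conj G" "A = Inn G #>\<^bsub>ConjGroup G\<^esub> f"
      unfolding RCOSETS_def by auto
    obtain g where g: "g \<in> carrier G" "(\<lambda>x\<in>carrier G. g \<otimes> f x \<otimes> inv g) \<in> T" using T(2)[OF f(1)] by blast
    let ?i = "\<lambda>x\<in>carrier G. g \<otimes> x \<otimes> inv g"
    have i: "?i \<in> Inn G" using g(1) unfolding Inn_def by blast
    have "f x \<in> carrier G" if "x \<in> carrier G" for x using ConjD(4)[OF f(1)] that by blast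
    then have "(\<lambda>x\<in>carrier G. g \<otimes> f x \<otimes> inv g) = ?i \<otimes>\<^bsub>ConjGroup G\<^esub> f"
      using i Inn_subset_Conj f(1) by (subst ConjGroup_mult) (auto simp: compose_def fun_eq_iff)
    moreover have "Inn G #>\<^bsub>ConjGroup G\<^esub> (?i \<otimes>\<^bsub>ConjGroup G\<^esub> f) = A"
      using C.repr_independence[OF _ _ subgroup_Inn, of "?i \<otimes>\<^bsub>ConjGroup G\<^esub> f" f] i f
      unfolding r_coset_def by auto
    ultimately show "A \<in> (\<lambda>f. Inn G #>\<^bsub>ConjGroup G\<^esub> f) ` T" using g(2) by force
  qed
  then show ?thesis
    unfolding finite_index_def using subgroup_Inn T(1) finite_subset by blast
qed

lemma hom_eq_on_generate:
  assumes f: "f \<in> hom G G" and h: "h \<in> hom G G" and S: "S \<subseteq> carrier G"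
    and eq: "\<And>s. s \<in> S \<Longrightarrow> f s = h s" and x: "x \<in> generate G S"
  shows "f x = h x"
proof -
  interpret f: group_hom G G f by (unfold_locales) (rule f)
  interpret h: group_hom G G h by (unfold_locales) (rule h)
  show ?thesis
    using x
  proof (induction rule: generate.induct)
    case (eng x y)
    then show ?case using generate_in_carrier[OF S] by simp
  next
    case (inv x)
    then have "x \<in> carrier G" using S by blast
    then show ?case using eq inv by simp
  qed (use eq S in auto)
qed

lemma finite_Conj_generators:
  assumes S: "finite S" "S \<subseteq> carrier G" "generate G S = carrier G" and F: "finite F"
  shows "finite {f \<in> Conj G. \<forall>s\<in>S. f s \<in> F}"
proof (rule inj_on_finite)
  show "inj_on (\<lambda>f. restrict f S) {f \<in> Conj G. \<forall>s\<in>S. f s \<in> F}"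
  proof (rule inj_onI)
    fix f h assume f: "f \<in> {f \<in> Conj G. \<forall>s\<in>S. f s \<in> F}" and h: "h \<in> {f \<in> Conj G. \<forall>s\<in>S. f s \<in> F}"
      and "restrict f S = restrict h S"
    then have "f s = h s" if "s \<in> S" for s using that by (metis restrict_apply')
    then have "f x = h x" if "x \<in> carrier G" for x
      using hom_eq_on_generate[of f h S x] f h ConjD(1) S that by auto
    moreover have "f \<in> extensional (carrier G)" "h \<in> extensional (carrier G)"
      using f h ConjD(2) Bij_imp_extensional by auto
    ultimately show "f = h" by (metis extensionalityI)
  qed
  show "(\<lambda>f. restrict f S) ` {f \<in> Conj G. \<forall>s\<in>S. f s \<in> F} \<subseteq> (S \<rightarrow>\<^sub>E F)" by auto
  show "finite (S \<rightarrow>\<^sub>E F)" using S(1) F by (simp add: finite_PiE)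
qed

end

section \<open>Short representatives of outer classes\<close>

context hyperbolic_action
begin

lemma ex_boundary_point:
  assumes "infinite (carrier G)" shows "\<exists>p :: (nat \<Rightarrow> 'x) set. p \<in> gromov_boundary"
proof -
  fix w :: 'x
  have "\<exists>g. real n < dist (\<phi> g w) w" for n :: nat
    using infinite_unbounded[OF assms subset_refl] by metis
  then obtain g where g: "\<And>n. real n < dist (\<phi> (g n) w) w" by metis
  have "filterlim (\<lambda>n. dist (\<phi> (g n) w) w) at_top sequentially"
    by (rule filterlim_at_top_mono[OF filterlim_real_sequentially]) (intro always_eventually allI less_imp_le g)
  then obtain r where "(\<lambda>n. \<phi> (g n) w) \<circ> r \<in> gromov_sequences"
    using ex_gromov_subsequence[of "\<lambda>n. \<phi> (g n) w" w] by blast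
  then show ?thesis using gromov_sequence_in_boundary by blast
qed

text \<open>The hull needs lines. A conical point comes with distinct points \<open>a\<close> and
  \<open>b\<close>; a parabolic point is moved by some element, as its stabiliser is not the whole
  group.\<close>

lemma ex_distinct_boundary_points:
  assumes inf: "infinite (carrier G)"
    and gf: "geometrically_finite G bdry_top (boundary_action \<phi>)"
    and proper: "carrier G \<notin> maximal_parabolic_subgroups G bdry_top (boundary_action \<phi>)"
  obtains \<xi> \<eta> :: "(nat \<Rightarrow> 'x) set" where "\<xi> \<in> gromov_boundary" "\<eta> \<in> gromov_boundary" "\<xi> \<noteq> \<eta>"
proof -
  obtain p :: "(nat \<Rightarrow> 'x) set" where p: "p \<in> gromov_boundary" using ex_boundary_point[OF inf] by blast
  show thesis
  proof (cases "conical_limit_point G bdry_top (boundary_action \<phi>) p")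
    case True
    then show thesis using that unfolding conical_limit_point_def topspace_boundary_topology by metis
  next
    case False
    then have bp: "bounded_parabolic_point G bdry_top (boundary_action \<phi>) p"
      using gf p unfolding geometrically_finite_def by auto
    then have "Stab p \<noteq> carrier G"
      using proper p unfolding maximal_parabolic_subgroups_def by (auto simp: stabilizer_eq_Stab)
    then obtain g where "g \<in> carrier G" "push (\<phi> g) p \<noteq> p" unfolding Stab_def by blast
    then show thesis using that[OF p push_in_boundary[OF _ p]] by metis
  qed
qed

text \<open>As \<open>f\<close> is onto, the conjugated images of the generators still generate the
  group.\<close>

lemma conj_generators_in_Stab:
  assumes f: "f \<in> Conj G" and g: "g \<in> carrier G" and S: "S \<subseteq> carrier G" "generate G S = carrier G"
    and stab: "\<And>s. s \<in> S \<Longrightarrow> g \<otimes> f s \<otimes> inv g \<in> Stab p"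
  shows "Stab p = carrier G"
proof -
  interpret f: group_hom G G f by (unfold_locales) (rule ConjD(1)[OF f])
  have 1: "g \<otimes> f x \<otimes> inv g \<in> Stab p" if "x \<in> generate G S" for x
    using that
  proof (induction rule: generate.induct)
    case one
    then show ?case using g Stab_one by simp
  next
    case (incl s)
    then show ?case by (rule stab)
  next
    case (inv s)
    then have s: "s \<in> carrier G" using S by blast
    have "inv (g \<otimes> f s \<otimes> inv g) = g \<otimes> f (inv s) \<otimes> inv g"
      using s g by (simp add: inv_mult_group m_assoc)
    then show ?case using Stab_inv[OF stab[OF inv]] by simp
  next
    case (eng x y)
    then have "x \<in> carrier G" "y \<in> carrier G" using generate_in_carrier[OF S(1)] by auto
    then show ?case using Stab_mult[OF eng.IH] conj_mult[OF g, of "f x" "f y"] by simp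
  qed
  have "y \<in> Stab p" if y: "y \<in> carrier G" for y
  proof -
    have "inv g \<otimes> y \<otimes> g \<in> f ` carrier G" using ConjD(4)[OF f] y g by simp
    then obtain x where "x \<in> carrier G" "f x = inv g \<otimes> y \<otimes> g" by force
    then show ?thesis using 1[of x] S(2) conj_inv_conj(2)[OF g y] by simp
  qed
  then show ?thesis unfolding Stab_def by blast
qed

lemma nearest_translate:
  obtains g where "g \<in> carrier G" "\<And>h. h \<in> carrier G \<Longrightarrow> dist (\<phi> g x) w \<le> dist (\<phi> g x) (\<phi> h w) + 1"
proof -
  let ?D = "(\<lambda>g. dist (\<phi> g x) w) ` carrier G"
  have bdd: "bdd_below ?D" by (auto intro: bdd_belowI[of _ 0])
  have "Inf ?D < Inf ?D + 1" by simp
  then obtain g where g: "g \<in> carrier G" "dist (\<phi> g x) w < Inf ?D + 1"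
    using cInf_lessD[of ?D] by blast
  have "dist (\<phi> g x) w \<le> dist (\<phi> g x) (\<phi> h w) + 1" if h: "h \<in> carrier G" for h
  proof -
    have "Inf ?D \<le> dist (\<phi> (inv h \<otimes> g) x) w" using bdd h g by (intro cInf_lower) auto
    also have "\<dots> = dist (\<phi> g x) (\<phi> h w)"
      using h g dist_action_inv[OF h] by (simp add: action_mult)
    finally show ?thesis using g(2) by linarith
  qed
  then show thesis using that g(1) by blast
qed

text \<open>For a conjugating automorphism \<open>f\<close> the elements \<open>f s\<close> and \<open>f s \<otimes> f t\<close> have the same
  translation lengths as \<open>s\<close> and \<open>s \<otimes> t\<close>, so the coarse Serre lemma applies to \<open>f ` S\<close>.\<close>

lemma conj_almost_fixed_point:
  assumes S: "finite S" "S \<subseteq> carrier G" and C: "2 * \<delta> + 1 \<le> C" and w: "w \<in> boundary_hull C"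
  obtains L where "0 \<le> L"
    "\<And>f. f \<in> Conj G \<Longrightarrow> \<exists>x\<in>boundary_hull C. \<forall>s\<in>S. dist x (\<phi> (f s) x) \<le> L"
proof -
  \<comment> \<open>The sums are just common upper bounds for how far the \<open>s\<close> and
    \<open>s \<otimes> t\<close> move \<open>w\<close>; a conjugate by \<open>h\<close> moves
    \<open>\<phi> h w\<close> equally far.\<close>
  define K1 where "K1 = (\<Sum>s\<in>S. dist w (\<phi> s w))"
  define K2 where "K2 = (\<Sum>(s, t)\<in>S\<times>S. dist w (\<phi> (s \<otimes> t) w))"
  define K where "K = C + 8 * \<delta> + K1 + K2"
  have pos: "0 \<le> K1" "0 \<le> K2" unfolding K1_def K2_def by (auto intro!: sum_nonneg)
  have K: "\<delta> \<le> K" "C + 8 * \<delta> \<le> K" "K1 \<le> K" "K2 \<le> K"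
    using pos C delta_ge_1 unfolding K_def by linarith+
  have K1: "dist w (\<phi> s w) \<le> K" if "s \<in> S" for s
    using that S(1) K(3) member_le_sum[of s S "\<lambda>s. dist w (\<phi> s w)"] unfolding K1_def by auto
  have K2: "dist w (\<phi> (s \<otimes> t) w) \<le> K" if "s \<in> S" "t \<in> S" for s t
    using that S(1) K(4) member_le_sum[of "(s, t)" "S \<times> S" "\<lambda>(s, t). dist w (\<phi> (s \<otimes> t) w)"]
    unfolding K2_def by auto
  have "rough_geodesic 1 (UNIV :: 'x set)"
    unfolding rough_geodesic_def
  proof (intro ballI allI impI)
    fix x y :: 'x and t assume "0 \<le> t \<and> t \<le> dist x y"
    then obtain z where "dist x z = t" "dist z y \<le> dist x y - t + 1"
      using path_metric_space_between[OF path_metric, of t x y 1] by auto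
    then show "\<exists>z\<in>UNIV. dist x z \<le> t + 1 \<and> dist z y \<le> dist x y - t + 1" by force
  qed
  then have "rough_geodesic (C + 8 * \<delta>) (boundary_hull C)"
    using C by (rule rough_geodesic_boundary_hull)
  then have rough: "rough_geodesic K (boundary_hull C)"
    using K(2) by (rule rough_geodesic_mono)
  have "\<exists>x\<in>boundary_hull C. \<forall>s\<in>S. dist x (\<phi> (f s) x) \<le> 400 * K" if f: "f \<in> Conj G" for f
  proof (rule common_almost_fixed_point[OF K(1) rough _ S(1)])
    have fG: "f x \<in> carrier G" if "x \<in> carrier G" for x using ConjD(4)[OF f] that by blast
    have displ: "\<exists>z. dist z (\<phi> (f x) z) \<le> K" if x: "x \<in> carrier G" "dist w (\<phi> x w) \<le> K" for x
    proof -
      obtain h where h: "h \<in> carrier G" "f x = h \<otimes> x \<otimes> inv h" using ConjD(5)[OF f x(1)] by blast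
      have "dist (\<phi> h w) (\<phi> (f x) (\<phi> h w)) = dist w (\<phi> x w)"
        using h x(1) by (simp add: action_mult dist_action)
      then show ?thesis using x(2) by metis
    qed
    show "boundary_hull C \<noteq> {}" using w by blast
    show "isometry (\<phi> (f s))" if "s \<in> S" for s using isometry_action fG S that by blast
    show "\<phi> (f s) x \<in> boundary_hull C" if "s \<in> S" "x \<in> boundary_hull C" for s x
      using boundary_hull_action fG S that by blast
    show "\<exists>z. dist z (\<phi> (f s) z) \<le> K" if "s \<in> S" for s using displ K1 S that by blast
    show "\<exists>z. dist z (\<phi> (f s) (\<phi> (f t) z)) \<le> K" if st: "s \<in> S" "t \<in> S" for s t
    proof -
      have stG: "s \<in> carrier G" "t \<in> carrier G" using st S by auto
      have "\<phi> (f (s \<otimes> t)) = \<phi> (f s) \<circ> \<phi> (f t)"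
        using ConjD(1)[OF f] stG fG by (simp add: hom_mult action_mult)
      then show ?thesis using displ[of "s \<otimes> t"] K2[OF st] stG by simp
    qed
  qed
  then show thesis using that[of "400 * K"] K(1) delta_ge_1 by simp
qed

theorem short_representatives:
  assumes S: "finite S" "S \<subseteq> carrier G" "generate G S = carrier G" and inf: "infinite (carrier G)"
    and gf: "geometrically_finite G bdry_top (boundary_action \<phi>)"
    and proper: "carrier G \<notin> maximal_parabolic_subgroups G bdry_top (boundary_action \<phi>)"
  shows "\<exists>R. \<forall>f\<in>Conj G. \<exists>g\<in>carrier G. \<forall>s\<in>S. dist (\<phi> (g \<otimes> f s \<otimes> inv g) w) w \<le> R"
proof (rule ccontr)
  assume neg: "\<not> ?thesis"
  obtain \<xi> \<eta> :: "(nat \<Rightarrow> 'x) set" where \<xi>: "\<xi> \<in> gromov_boundary" "\<eta> \<in> gromov_boundary" "\<xi> \<noteq> \<eta>"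
    using ex_distinct_boundary_points[OF inf gf proper] by blast
  obtain C0 where C0: "gromov_le w \<xi> \<eta> C0" using gromov_le_distinct[OF \<xi>] by blast
  \<comment> \<open>The hull is made large enough to contain the base point, as the horoball
    estimates require.\<close>
  define C where "C = max (2 * \<delta> + 1) C0"
  have w: "w \<in> boundary_hull C"
    using \<xi>(1,2) gromov_le_mono[OF C0, of C] unfolding boundary_hull_def C_def by auto
  obtain L where L: "0 \<le> L"
      "\<And>f. f \<in> Conj G \<Longrightarrow> \<exists>x\<in>boundary_hull C. \<forall>s\<in>S. dist x (\<phi> (f s) x) \<le> L"
    using conj_almost_fixed_point[OF S(1,2) _ w] unfolding C_def by (metis max.cobounded1)
  have "\<exists>f g x. f \<in> Conj G \<and> g \<in> carrier G \<and> x \<in> boundary_hull C \<and> real n < dist x w \<and>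
      (\<forall>h\<in>carrier G. dist x w \<le> dist x (\<phi> h w) + 1) \<and>
      (\<forall>s\<in>S. dist (\<phi> (g \<otimes> f s \<otimes> inv g) x) x \<le> L)" for n
  proof -
    \<comment> \<open>An isometry that moves \<open>\<phi> g x\<close> by at most \<open>L\<close>
      moves \<open>w\<close> by at most \<open>2 * dist (\<phi> g x) w + L\<close>; the threshold
      thus forces \<open>dist (\<phi> g x) w\<close> above \<open>real n\<close>.\<close>
    obtain f where f: "f \<in> Conj G"
        "\<And>g. g \<in> carrier G \<Longrightarrow> \<exists>s\<in>S. 2 * real n + L < dist (\<phi> (g \<otimes> f s \<otimes> inv g) w) w"
      using neg by (meson not_le)
    obtain x where x: "x \<in> boundary_hull C" "\<And>s. s \<in> S \<Longrightarrow> dist x (\<phi> (f s) x) \<le> L"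
      using L(2)[OF f(1)] by blast
    obtain g where g: "g \<in> carrier G"
        "\<And>h. h \<in> carrier G \<Longrightarrow> dist (\<phi> g x) w \<le> dist (\<phi> g x) (\<phi> h w) + 1"
      using nearest_translate by blast
    have fG: "f s \<in> carrier G" if "s \<in> S" for s using ConjD(4)[OF f(1)] S that by blast
    have displ: "dist (\<phi> (g \<otimes> f s \<otimes> inv g) (\<phi> g x)) (\<phi> g x) \<le> L" if "s \<in> S" for s
      using x(2)[OF that] fG[OF that] g(1) by (simp add: action_mult dist_action dist_commute)
    obtain s where s: "s \<in> S" "2 * real n + L < dist (\<phi> (g \<otimes> f s \<otimes> inv g) w) w" using f(2)[OF g(1)] by blast
    let ?k = "g \<otimes> f s \<otimes> inv g"
    have "?k \<in> carrier G" using g(1) fG[OF s(1)] by simp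
    then have "dist (\<phi> ?k w) (\<phi> ?k (\<phi> g x)) = dist w (\<phi> g x)" by (rule dist_action)
    then have "dist (\<phi> ?k w) w \<le> 2 * dist (\<phi> g x) w + L"
      using displ[OF s(1)] dist_triangle[of "\<phi> ?k w" w "\<phi> ?k (\<phi> g x)"]
        dist_triangle[of "\<phi> ?k (\<phi> g x)" w "\<phi> g x"] by (simp add: dist_commute)
    then have "real n < dist (\<phi> g x) w" using s(2) by linarith
    then show ?thesis
      using f(1) g displ boundary_hull_action[OF g(1) x(1)]
      by (intro exI[of _ f] exI[of _ g] exI[of _ "\<phi> g x"]) auto
  qed
  then obtain f g x where f: "\<And>n. f n \<in> Conj G" and g: "\<And>n. g n \<in> carrier G"
    and x: "\<And>n. x n \<in> boundary_hull C" "\<And>n. real n < dist (x n) w"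
    and nearest: "\<And>n h. h \<in> carrier G \<Longrightarrow> dist (x n) w \<le> dist (x n) (\<phi> h w) + 1"
    and displ: "\<And>n s. s \<in> S \<Longrightarrow> dist (\<phi> (g n \<otimes> f n s \<otimes> inv (g n)) (x n)) (x n) \<le> L"
    by metis
  have "filterlim (\<lambda>n. dist (x n) w) at_top sequentially"
    by (rule filterlim_at_top_mono[OF filterlim_real_sequentially]) (intro always_eventually allI less_imp_le x)
  then obtain r where "x \<circ> r \<in> gromov_sequences" using ex_gromov_subsequence by blast
  then obtain p where p: "p \<in> gromov_boundary" "x \<circ> r \<in> p" using gromov_sequence_in_boundary by blast
  have "\<not> conical_limit_point G bdry_top (boundary_action \<phi>) p"
    using conical_not_limit[OF p(1) _ inf p(2), of w] nearest by (metis comp_apply not_le)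
  then have bp: "bounded_parabolic_point G bdry_top (boundary_action \<phi>) p"
    using gf p(1) unfolding geometrically_finite_def by auto
  obtain i where i: "\<And>h. h \<in> carrier G \<Longrightarrow> dist (\<phi> h ((x \<circ> r) i)) ((x \<circ> r) i) \<le> L \<Longrightarrow> h \<in> Stab p"
    using parabolic_limit_fixes[OF bp w p(2), of L] x(1) nearest by (metis comp_apply)
  have "g (r i) \<otimes> f (r i) s \<otimes> inv (g (r i)) \<in> Stab p" if s: "s \<in> S" for s
  proof (rule i)
    have "f (r i) s \<in> carrier G" using ConjD(4)[OF f] S(2) s by blast
    then show "g (r i) \<otimes> f (r i) s \<otimes> inv (g (r i)) \<in> carrier G" using g by simp
  qed (use displ[OF s] in simp)
  then have "Stab p = carrier G" by (rule conj_generators_in_Stab[OF f g S(2,3)])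
  then show False
    using proper bp p(1) unfolding maximal_parabolic_subgroups_def
    by (auto simp: stabilizer_eq_Stab)
qed

end

theorem lemma2p2:
  fixes G :: "('g, 'm) monoid_scheme"
  assumes "group G"
    and "relatively_hyperbolic TYPE('x::metric_space) G"
  shows "finite_index (Inn G) (ConjGroup G)"
proof -
  interpret group G by (rule assms(1))
  obtain \<phi> :: "'g \<Rightarrow> 'x \<Rightarrow> 'x" where fg: "finitely_generated_subgroup G (carrier G)"
    and sp: "proper_space TYPE('x)" "gromov_hyperbolic TYPE('x)" "path_metric_space TYPE('x)"
    and act: "isometric_action G \<phi>" "properly_discontinuous G euclidean \<phi>"
      "convergence_group G boundary_topology (boundary_action \<phi>)"
    and gf: "geometrically_finite G boundary_topology (boundary_action \<phi>)"
    and npar: "carrier G \<notin> maximal_parabolic_subgroups G boundary_topology (boundary_action \<phi>)"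
    using assms(2) unfolding relatively_hyperbolic_def hyperbolic_relative_to_def by blast
  obtain S where S: "finite S" "S \<subseteq> carrier G" "generate G S = carrier G"
    using fg unfolding finitely_generated_subgroup_def by blast
  obtain \<delta>0 where \<delta>0: "\<And>w x y z :: 'x.
      min (gromov_product w x y) (gromov_product w y z) - \<delta>0 \<le> gromov_product w x z"
    using sp(2) unfolding gromov_hyperbolic_def by blast
  have grp: "group_action G gromov_boundary (boundary_action \<phi>)"
    using act(3) unfolding convergence_group_def by simp
  interpret hyperbolic_action "TYPE('x)" "max 1 \<delta>0" G \<phi>
  proof (intro hyperbolic_action.intro hyperbolic.intro hyperbolic_action_axioms.intro)
    show "min (gromov_product w x y) (gromov_product w y z) - max 1 \<delta>0 \<le> gromov_product w x z"
      for w x y z :: 'x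
      using \<delta>0[of w x y z] by linarith
  qed (use sp act grp assms(1) in simp_all)
  \<comment> \<open>A finite group is its own \<open>F\<close>; the geometric argument needs
    unbounded orbits, hence an infinite group.\<close>
  have fin: "\<exists>F. finite F \<and> (\<forall>f\<in>Conj G. \<exists>g\<in>carrier G. \<forall>s\<in>S. g \<otimes>\<^bsub>G\<^esub> f s \<otimes>\<^bsub>G\<^esub> inv\<^bsub>G\<^esub> g \<in> F)"
  proof (cases "finite (carrier G)")
    case True
    have "g \<otimes>\<^bsub>G\<^esub> f s \<otimes>\<^bsub>G\<^esub> inv\<^bsub>G\<^esub> g \<in> carrier G" if "f \<in> Conj G" "g \<in> carrier G" "s \<in> S" for f g s
      using ConjD(4)[OF that(1)] S(2) that by blast
    then show ?thesis using True one_closed by blast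
  next
    case False
    fix w :: 'x
    obtain R where R: "\<forall>f\<in>Conj G. \<exists>g\<in>carrier G. \<forall>s\<in>S. dist (\<phi> (g \<otimes>\<^bsub>G\<^esub> f s \<otimes>\<^bsub>G\<^esub> inv\<^bsub>G\<^esub> g) w) w \<le> R"
      using short_representatives[OF S False gf npar] by blast
    have "g \<otimes>\<^bsub>G\<^esub> f s \<otimes>\<^bsub>G\<^esub> inv\<^bsub>G\<^esub> g \<in> carrier G" if "f \<in> Conj G" "g \<in> carrier G" "s \<in> S" for f g s
      using ConjD(4)[OF that(1)] S(2) that by blast
    then have "\<forall>f\<in>Conj G. \<exists>g\<in>carrier G. \<forall>s\<in>S.
        g \<otimes>\<^bsub>G\<^esub> f s \<otimes>\<^bsub>G\<^esub> inv\<^bsub>G\<^esub> g \<in> {h \<in> carrier G. dist (\<phi> h w) w \<le> R}"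
      using R by fastforce
    then show ?thesis using finite_ball by blast
  qed
  then obtain F where F: "finite F"
      "\<And>f. f \<in> Conj G \<Longrightarrow> \<exists>g\<in>carrier G. \<forall>s\<in>S. g \<otimes>\<^bsub>G\<^esub> f s \<otimes>\<^bsub>G\<^esub> inv\<^bsub>G\<^esub> g \<in> F"
    by blast
  \<comment> \<open>The finite set of representatives consists of the conjugating automorphisms that
    map \<open>S\<close> into \<open>F\<close>.\<close>
  show ?thesis
  proof (rule finite_index_InnI[OF finite_Conj_generators[OF S F(1)]])
    fix f assume f: "f \<in> Conj G"
    then obtain g where g: "g \<in> carrier G" "\<forall>s\<in>S. g \<otimes>\<^bsub>G\<^esub> f s \<otimes>\<^bsub>G\<^esub> inv\<^bsub>G\<^esub> g \<in> F" using F(2) by blast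
    let ?i = "\<lambda>x\<in>carrier G. g \<otimes>\<^bsub>G\<^esub> x \<otimes>\<^bsub>G\<^esub> inv\<^bsub>G\<^esub> g"
    have i: "?i \<in> Conj G" using Inn_subset_Conj g(1) unfolding Inn_def by blast
    have "(\<lambda>x\<in>carrier G. g \<otimes>\<^bsub>G\<^esub> f x \<otimes>\<^bsub>G\<^esub> inv\<^bsub>G\<^esub> g) = compose (carrier G) ?i f"
      using ConjD(4)[OF f] by (auto simp: compose_def fun_eq_iff)
    also have "\<dots> \<in> Conj G"
      using subgroup.m_closed[OF subgroup_Conj i f] ConjD(2)[OF f] ConjD(2)[OF i]
      by (simp add: BijGroup_def)
    finally show "\<exists>g\<in>carrier G. (\<lambda>x\<in>carrier G. g \<otimes>\<^bsub>G\<^esub> f x \<otimes>\<^bsub>G\<^esub> inv\<^bsub>G\<^esub> g) \<in> {f \<in> Conj G. \<forall>s\<in>S. f s \<in> F}"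
      using g S(2) by (intro bexI[of _ g]) (auto simp: subset_iff)
  qed
qed

end
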